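(* Consider the system $x(k+1)=A(k)x(k)+B(k)u(k)$, $x(0)=x_0\in\mathbb{R}^n$, composed of $N$ subsystems with the random matrices $A(k)$ satisfying the independence assumptions in the context. Suppose that the probability distribution of the matrices $\{A(k)\}_{k=0}^\infty$ is constant in time, that $B(k)=B\in\mathbb{R}^{n\times m}$ for all $k\ge0$, and that the system is mean square stabilizable under limited model information (defined in the context). Let $Q\in\mathcal{S}_{++}^n$, $R=\mathrm{diag}(R_{11},\dots,R_{NN})\in\mathcal{S}_{++}^m$ with $R_{ii}\in\mathbb{R}^{m_i\times m_i}$, and $$J_\infty(x_0,\{u(k)\}_{k=0}^\infty)=\lim_{T\to\infty}\mathbb{E}\Big\{\sum_{k=0}^{T-1}\big(x(k)^\top Qx(k)+u(k)^\top Ru(k)\big)\Big\}.$$ Then the solution of the problem of minimizing $J_\infty$ over all control laws with limited model information (defined in the context) is given by $$u(k)=-(R+B^\top PB)^{-1}B^\top P\bar A x(k)-\begin{bmatrix}(R_{11}+B_1^\top PB_1)^{-1}B_1^\top P\tilde A_1(k)\\ \vdots\\ (R_{NN}+B_N^\top PB_N)^{-1}B_N^\top P\tilde A_N(k)\end{bmatrix}x(k),$$ where $\bar A=\mathbb{E}\{A(k)\}$ and $P$ is the unique finite positive-definite solution of the modified discrete algebraic Riccati equation $$P=Q+\mathbf{R}(\bar A,P,B,R)+\sum_{i=1}^N\mathbb{E}\{\mathbf{R}(\tilde A_i(k),P,B_i,R_{ii})\}.$$ Furthermore, the closed-loop system under this controller is mean square stable, and $\inf_{\{u(k)\}_{k=0}^\infty}J_\infty(x_0,\{u(k)\}_{k=0}^\infty)=x_0^\top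 Px_0$, the infimum being over control laws with limited model information.
   Context: Notation: $\mathcal{S}_{+}^n$ ($\mathcal{S}_{++}^n$) is the set of symmetric positive semidefinite (positive definite) matrices in $\mathbb{R}^{n\times n}$. The discrete Riccati operator is $\mathbf{R}(A,P,B,R)=A^\top(P-PB(R+B^\top PB)^{-1}B^\top P)A$ for $A\in\mathbb{R}^{n\times n}$, $P\in\mathcal{S}_+^n$, $B\in\mathbb{R}^{n\times m}$, $R\in\mathcal{S}_{++}^m$ (for any positive integers $n,m$). System: there are $N$ subsystems, subsystem $i$ having state $x_i(k)\in\mathbb{R}^{n_i}$, input $u_i(k)\in\mathbb{R}^{m_i}$ and dynamics $x_i(k+1)=\sum_{j=1}^N A_{ij}(k)x_j(k)+B_{ii}(k)u_i(k)$. Put $n=\sum_i n_i$, $m=\sum_i m_i$, $x(k)=[x_1(k)^\top\cdots x_N(k)^\top]^\top$, $u(k)=[u_1(k)^\top\cdots u_N(k)^\top]^\top$; then $x(k+1)=A(k)x(k)+B(k)u(k)$, with $A(k)=[A_{ij}(k)]_{i,j}$ and $B(k)=\mathrm{diag}(B_{11}(k),\dots,B_{NN}(k))$. The matrices $B_{ii}(k)$ and the initial state $x_0$ are deterministic; the $A_{ij}(k)\in\mathbb{R}^{n_i\times n_j}$ are random with finite first and second moments. Independence assumptions: the block rows $[A_{i1}(k)\;\cdots\;A_{iN}(k)]$, $1\le i\le N$, $k\ge0$, are mutually independent, both in time $k$ and across subsystems $i$ (blocks within the same block row at the same time may be dependent). Write $\tilde A_{ij}(k)=A_{ij}(k)-\mathbb{E}\{A_{ij}(k)\}$.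 When $B(k)=B$, $B_i\in\mathbb{R}^{n\times m_i}$ is the $i$-th block column of $B$ (its $i$-th block is $B_{ii}$, all other blocks are zero). $\tilde A_i(k)\in\mathbb{R}^{n\times n}$ has $i$-th block row $[\tilde A_{i1}(k)\;\cdots\;\tilde A_{iN}(k)]$ and all other block rows zero. Control laws with limited model information: the design of controller $i$ may use the exact local realizations $A_{i1}(k),\dots,A_{iN}(k)$ together with the first- and second-order moments of the $A(k)$, and the controller measures the full state. That is, at each time $k$, $u_i(k)=\psi_i(A_{i1}(k),\dots,A_{iN}(k);x(0),\dots,x(k))$ for $1\le i\le N$, where $\psi_i$ (possibly depending on $k$) is an arbitrary measurable mapping into $\mathbb{R}^{m_i}$, not necessarily linear. A closed-loop system is mean square stable if $\lim_{k\to+\infty}\mathbb{E}\{x(k)^\top x(k)\}=0$ for every initial state $x_0$. The system is mean square stabilizable under limited model information if there exist (measurable) mappings $\Gamma_i:\mathbb{R}^{n_i\times n_1}\times\cdots\times\mathbb{R}^{n_i\times n_N}\to\mathbb{R}^{m_i\times n}$, $1\le i\le N$, such that the closed-loop system with $u_i(k)=\Gamma_i(A_{i1}(k),\dots,A_{iN}(k))x(k)$, $1\le i\le N$, is mean square stable. *)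

theory Defs
  imports "HOL-Probability.Probability"
begin

text \<open>
  State coordinates are indexed by a finite type \<open>'n\<close> and input coordinates by \<open>'m\<close>; the maps
  \<open>sx :: 'n \<Rightarrow> 's\<close> and \<open>su :: 'm \<Rightarrow> 's\<close> tell to which of the \<open>N = CARD('s)\<close> subsystems a coordinate
  belongs.  Hence \<open>n\<^sub>i = card {a. sx a = i}\<close> and \<open>m\<^sub>i = card {c. su c = i}\<close>, and vectors and
  matrices living on the coordinates of one subsystem are represented in the full space, padded
  with zeros.
\<close>

definition block_row :: "('a \<Rightarrow> 's) \<Rightarrow> 's \<Rightarrow> real^'b^'a \<Rightarrow> real^'b^'a" where
  "block_row f i M = (\<chi> a b. if f a = i then M $ a $ b else 0)"

definition block_col :: "('b \<Rightarrow> 's) \<Rightarrow> 's \<Rightarrow> real^'b^'a \<Rightarrow> real^'b^'a" where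
  "block_col g i M = (\<chi> a b. if g b = i then M $ a $ b else 0)"

definition diag_block :: "('a \<Rightarrow> 's) \<Rightarrow> 's \<Rightarrow> real^'a^'a \<Rightarrow> real^'a^'a" where
  "diag_block f i M = (\<chi> a b. if f a = i \<and> f b = i then M $ a $ b else 0)"

definition block_diagonal :: "('a \<Rightarrow> 's) \<Rightarrow> ('b \<Rightarrow> 's) \<Rightarrow> real^'b^'a \<Rightarrow> bool" where
  "block_diagonal f g M \<longleftrightarrow> (\<forall>a b. f a \<noteq> g b \<longrightarrow> M $ a $ b = 0)"

definition sym_pos_def :: "real^'a^'a \<Rightarrow> bool" where
  "sym_pos_def M \<longleftrightarrow> transpose M = M \<and> (\<forall>v. v \<noteq> 0 \<longrightarrow> v \<bullet> (M *v v) > 0)"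

definition mat_on :: "'a set \<Rightarrow> real^'a^'a" where
  "mat_on I = (\<chi> a b. if a = b \<and> a \<in> I then 1 else 0)"

text \<open>
  The inverse of an \<open>I \<times> I\<close> matrix that is padded with zeros outside \<open>I \<times> I\<close>; the result is
  padded in the same way.
\<close>

definition inv_on :: "'a set \<Rightarrow> real^'a^'a \<Rightarrow> real^'a^'a" where
  "inv_on I M = (SOME M'. (\<forall>a b. \<not> (a \<in> I \<and> b \<in> I) \<longrightarrow> M' $ a $ b = 0) \<and>
     M ** M' = mat_on I \<and> M' ** M = mat_on I)"

lemma inv_on_UNIV: "inv_on UNIV M = matrix_inv M"
  by (simp add: inv_on_def matrix_inv_def mat_on_def mat_def)

lemma inv_on_eqI:
  fixes M M' :: "real^'a^'a"
  assumes supp: "\<And>a b. \<not> (a \<in> I \<and> b \<in> I) \<Longrightarrow> M' $ a $ b = 0"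
    and inv: "M ** M' = mat_on I" "M' ** M = mat_on I"
  shows "inv_on I M = M'"
proof -
  have left: "mat_on I ** X = X" and right: "X ** mat_on I = X"
    if X: "\<And>a b. \<not> (a \<in> I \<and> b \<in> I) \<Longrightarrow> X $ a $ b = 0" for X :: "real^'a^'a"
  proof -
    have "(\<Sum>k\<in>UNIV. mat_on I $ a $ k * X $ k $ b) = (\<Sum>k\<in>UNIV. if k = a then X $ k $ b else 0)" for a b
      by (rule sum.cong) (use X in \<open>auto simp: mat_on_def\<close>)
    then show "mat_on I ** X = X" by (simp add: vec_eq_iff matrix_matrix_mult_def)
    have "(\<Sum>k\<in>UNIV. X $ a $ k * mat_on I $ k $ b) = (\<Sum>k\<in>UNIV. if k = b then X $ a $ k else 0)" for a b
      by (rule sum.cong) (use X in \<open>auto simp: mat_on_def\<close>)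
    then show "X ** mat_on I = X" by (simp add: vec_eq_iff matrix_matrix_mult_def)
  qed
  let ?X = "inv_on I M"
  have X: "(\<forall>a b. \<not> (a \<in> I \<and> b \<in> I) \<longrightarrow> ?X $ a $ b = 0) \<and> M ** ?X = mat_on I \<and> ?X ** M = mat_on I"
    unfolding inv_on_def by (rule someI[of _ M']) (use assms in auto)
  have "?X = ?X ** (M ** M')" using X right[of ?X] inv by simp
  also have "\<dots> = mat_on I ** M'" using X by (simp add: matrix_mul_assoc)
  also have "\<dots> = M'" using left[of M'] supp by simp
  finally show ?thesis .
qed

definition riccati :: "real^'n^'n \<Rightarrow> real^'n^'n \<Rightarrow> real^'m^'n \<Rightarrow> real^'m^'m \<Rightarrow> real^'n^'n" where
  "riccati A P B R = transpose A **
     (P - P ** B ** matrix_inv (R + transpose B ** P ** B) ** transpose B ** P) ** A"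

text \<open>The same operator for an input whose coordinates are only those in \<open>I\<close>.\<close>

definition riccati_on ::
  "'m set \<Rightarrow> real^'n^'n \<Rightarrow> real^'n^'n \<Rightarrow> real^'m^'n \<Rightarrow> real^'m^'m \<Rightarrow> real^'n^'n" where
  "riccati_on I A P B R = transpose A **
     (P - P ** B ** inv_on I (R + transpose B ** P ** B) ** transpose B ** P) ** A"

lemma riccati_on_UNIV: "riccati_on UNIV = riccati"
  by (intro ext) (simp add: riccati_on_def riccati_def inv_on_UNIV)

text \<open>
  A law \<open>\<psi>\<close> maps a subsystem \<open>i\<close>, a time \<open>k\<close>, the padded \<open>i\<close>-th block row of the current system
  matrix and the states up to time \<open>k\<close> to an input, of which only the coordinates of
  subsystem \<open>i\<close> are used.
\<close>

type_synonym ('s, 'n, 'm) law = "'s \<Rightarrow> nat \<Rightarrow> real^'n^'n \<Rightarrow> (nat \<Rightarrow> real^'n) \<Rightarrow> real^'m"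

definition limited_info :: "('s, 'n::finite, 'm::finite) law \<Rightarrow> bool" where
  "limited_info \<psi> \<longleftrightarrow>
     (\<forall>i k. (\<lambda>(S, h). \<psi> i k S h) \<in> borel \<Otimes>\<^sub>M (\<Pi>\<^sub>M j\<in>{..k}. borel) \<rightarrow>\<^sub>M borel)"

definition joint_input ::
  "('n \<Rightarrow> 's) \<Rightarrow> ('m \<Rightarrow> 's) \<Rightarrow> ('s, 'n, 'm) law \<Rightarrow> nat \<Rightarrow> real^'n^'n \<Rightarrow> (nat \<Rightarrow> real^'n) \<Rightarrow> real^'m"
where
  "joint_input sx su \<psi> k S h = (\<chi> c. \<psi> (su c) k (block_row sx (su c) S) h $ c)"

lemma restrict_fundef_cong [fundef_cong]:
  "I = J \<Longrightarrow> (\<And>x. x \<in> J \<Longrightarrow> f x = g x) \<Longrightarrow> restrict f I = restrict g J"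
  by (rule restrict_cong) (auto simp: simp_implies_def)

text \<open>Pathwise closed loop: \<open>S k\<close> is the realization of the system matrix at time \<open>k\<close>.\<close>

fun state ::
  "('n \<Rightarrow> 's) \<Rightarrow> ('m \<Rightarrow> 's) \<Rightarrow> real^'m^'n \<Rightarrow> ('s, 'n, 'm) law \<Rightarrow> real^'n \<Rightarrow> (nat \<Rightarrow> real^'n^'n) \<Rightarrow>
    nat \<Rightarrow> real^'n"
where
  "state sx su B \<psi> x0 S 0 = x0"
| "state sx su B \<psi> x0 S (Suc k) = S k *v state sx su B \<psi> x0 S k +
     B *v joint_input sx su \<psi> k (S k) (\<lambda>j\<in>{..k}. state sx su B \<psi> x0 S j)"

definition ctrl ::
  "('n \<Rightarrow> 's) \<Rightarrow> ('m \<Rightarrow> 's) \<Rightarrow> real^'m^'n \<Rightarrow> ('s, 'n, 'm) law \<Rightarrow> real^'n \<Rightarrow> (nat \<Rightarrow> real^'n^'n) \<Rightarrow>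
    nat \<Rightarrow> real^'m"
where
  "ctrl sx su B \<psi> x0 S k =
     joint_input sx su \<psi> k (S k) (\<lambda>j\<in>{..k}. state sx su B \<psi> x0 S j)"

text \<open>The Bochner integral is \<open>0\<close> for non-integrable functions, so integrability is explicit here.\<close>

definition mean_square_stable ::
  "'w measure \<Rightarrow> ('n \<Rightarrow> 's) \<Rightarrow> ('m \<Rightarrow> 's) \<Rightarrow> (nat \<Rightarrow> 'w \<Rightarrow> real^'n^'n) \<Rightarrow> real^'m^'n \<Rightarrow>
    ('s, 'n, 'm) law \<Rightarrow> bool"
where
  "mean_square_stable M sx su A B \<psi> \<longleftrightarrow> (\<forall>x0.
     let x = (\<lambda>k \<omega>. state sx su B \<psi> x0 (\<lambda>j. A j \<omega>) k) in
       (\<forall>k. integrable M (\<lambda>\<omega>. x k \<omega> \<bullet> x k \<omega>)) \<and>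
       (\<lambda>k. \<integral>\<omega>. x k \<omega> \<bullet> x k \<omega> \<partial>M) \<longlonglongrightarrow> 0)"

definition mean_square_stabilizable ::
  "'w measure \<Rightarrow> ('n \<Rightarrow> 's) \<Rightarrow> ('m \<Rightarrow> 's) \<Rightarrow> (nat \<Rightarrow> 'w \<Rightarrow> real^'n^'n) \<Rightarrow> real^'m^'n \<Rightarrow> bool"
where
  "mean_square_stabilizable M sx su A B \<longleftrightarrow>
     (\<exists>\<Gamma> :: 's \<Rightarrow> real^'n^'n \<Rightarrow> real^'n^'m. (\<forall>i. \<Gamma> i \<in> borel \<rightarrow>\<^sub>M borel) \<and>
        mean_square_stable M sx su A B (\<lambda>i k S h. \<Gamma> i S *v h k))"

text \<open>
  An admissible law may have infinite cost, so expectations of the nonnegative stage costs are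
  taken in \<open>[0, \<infinity>]\<close>; the limit exists by monotonicity.
\<close>

definition cost ::
  "'w measure \<Rightarrow> ('n \<Rightarrow> 's) \<Rightarrow> ('m \<Rightarrow> 's) \<Rightarrow> (nat \<Rightarrow> 'w \<Rightarrow> real^'n^'n) \<Rightarrow> real^'m^'n \<Rightarrow>
    real^'n^'n \<Rightarrow> real^'m^'m \<Rightarrow> real^'n \<Rightarrow> ('s, 'n, 'm) law \<Rightarrow> ennreal"
where
  "cost M sx su A B Q R x0 \<psi> =
     lim (\<lambda>T. \<integral>\<^sup>+\<omega>. ennreal (\<Sum>k<T.
       (let x = state sx su B \<psi> x0 (\<lambda>j. A j \<omega>) k; u = ctrl sx su B \<psi> x0 (\<lambda>j. A j \<omega>) k
        in x \<bullet> (Q *v x) + u \<bullet> (R *v u))) \<partial>M)"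

text \<open>
  The moments are taken at time \<open>0\<close>; they are used only when the law of \<open>A k\<close> does not depend
  on \<open>k\<close>.
\<close>

definition mean_mat :: "'w measure \<Rightarrow> (nat \<Rightarrow> 'w \<Rightarrow> real^'n^'n) \<Rightarrow> real^'n^'n" where
  "mean_mat M A = (\<integral>\<omega>. A 0 \<omega> \<partial>M)"

definition modified_riccati_eq ::
  "'w measure \<Rightarrow> ('n \<Rightarrow> 's::finite) \<Rightarrow> ('m \<Rightarrow> 's) \<Rightarrow> (nat \<Rightarrow> 'w \<Rightarrow> real^'n^'n) \<Rightarrow> real^'m^'n \<Rightarrow>
    real^'n^'n \<Rightarrow> real^'m^'m \<Rightarrow> real^'n^'n \<Rightarrow> bool"
where
  "modified_riccati_eq M sx su A B Q R P \<longleftrightarrow>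
     P = Q + riccati (mean_mat M A) P B R +
       (\<Sum>i\<in>UNIV. \<integral>\<omega>. riccati_on {c. su c = i} (block_row sx i (A 0 \<omega> - mean_mat M A)) P
          (block_col su i B) (diag_block su i R) \<partial>M)"

text \<open>
  Applied to \<open>S = block_row sx i (A k \<omega>)\<close>, the matrix \<open>S - block_row sx i (mean_mat M A)\<close> is the
  \<open>i\<close>-th centred block row.
\<close>

definition opt_law ::
  "'w measure \<Rightarrow> ('n \<Rightarrow> 's) \<Rightarrow> ('m \<Rightarrow> 's) \<Rightarrow> (nat \<Rightarrow> 'w \<Rightarrow> real^'n^'n) \<Rightarrow> real^'m^'n \<Rightarrow>
    real^'m^'m \<Rightarrow> real^'n^'n \<Rightarrow> ('s, 'n, 'm) law"
where
  "opt_law M sx su A B R P i k S h =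
     - ((matrix_inv (R + transpose B ** P ** B) ** transpose B ** P ** mean_mat M A) *v h k)
     - (let Bi = block_col su i B in
         (inv_on {c. su c = i} (diag_block su i R + transpose Bi ** P ** Bi)
            ** transpose Bi ** P ** (S - block_row sx i (mean_mat M A))) *v h k)"

end

theory Submission
  imports Defs
begin

text \<open>
  For a symmetric positive semidefinite \<open>P\<close> let \<open>F P\<close> (\<open>riccati_map\<close> below) be the sum of the mean
  Riccati term and the expected local Riccati terms, so that the modified Riccati equation reads
  \<open>P = Q + F P\<close>. Write \<open>q\<^sub>P x = x \<bullet> P x\<close>. The proof rests on one identity about a single step, on
  conditioning on the past, and on value iteration.

  \<^emph>\<open>One step.\<close> Fix the current state \<open>x\<close>, let \<open>S\<close> be the random system matrix, and let \<open>u\<close> be a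
  decentralized input, meaning that the coordinates of \<open>u\<close> in subsystem \<open>i\<close> depend on row block
  \<open>i\<close> of \<open>S\<close> only. With the feedback \<open>u*\<close> of the theorem and \<open>W = R + B\<^sup>T P B\<close>,
  \<open>E[q\<^sub>R u + q\<^sub>P (S x + B u)] = q\<^bsub>F P\<^esub> x + E[q\<^sub>W (u - u*)]\<close> (\<open>stage_cost\<close>). To see this, expand
  around \<open>u*\<close>. The gradient at \<open>u*\<close> is a sum over \<open>j\<close> of linear functions of the \<open>j\<close>-th centred
  row block, and the \<open>j\<close>-th summand vanishes on the coordinates of subsystem \<open>j\<close>. In the cross
  term, coordinates of subsystem \<open>i\<close> therefore meet only centred row blocks with \<open>j \<noteq> i\<close>, which are
  independent of them and have mean zero, so the cross term is \<open>0\<close> (\<open>gradient_orthogonal\<close>). The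
  same independence evaluates the cost of \<open>u*\<close> as \<open>q\<^bsub>F P\<^esub> x\<close> (\<open>quad_riccati_map\<close>). The identity is
  stated in \<open>[0, \<infinity>]\<close>, which covers inputs that are not square integrable.

  \<^emph>\<open>All steps.\<close> The matrix \<open>A k\<close> is independent of the past, so the one-step identity applies
  with the history frozen (\<open>nn_integral_condition_history\<close>). If \<open>P = Q + F P\<close>, summation over time
  shows that the cost up to time \<open>T\<close> plus \<open>E[q\<^sub>P (x\<^sub>T)]\<close> equals \<open>q\<^sub>P (x\<^sub>0)\<close> plus the accumulated
  regret \<open>\<Sum>\<^sub>k E[q\<^sub>W (u\<^sub>k - u\<^sub>k*)]\<close> (\<open>partial_cost\<close>). If the total cost is finite, then \<open>E[q\<^sub>Q (x\<^sub>k)]\<close>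
  tends to zero, hence so does \<open>E[q\<^sub>P (x\<^sub>T)]\<close>, and the cost is \<open>q\<^sub>P (x\<^sub>0)\<close> plus the total regret
  (\<open>cost_regret\<close>). Optimality, almost sure uniqueness of the optimal input, mean square stability
  and the value of the infimum follow; and since that infimum does not mention \<open>P\<close>, the equation
  has at most one positive definite solution.

  \<^emph>\<open>Existence.\<close> The iterates \<open>P\<^sub>0 = 0\<close>, \<open>P\<^bsub>T+1\<^esub> = Q + F P\<^sub>T\<close> increase because \<open>F\<close> is monotone. They
  are bounded: if \<open>\<Phi>\<close> is the random closed-loop matrix of a stabilizing feedback, then the powers of
  \<open>L Y = E[\<Phi>\<^sup>T Y \<Phi>]\<close> applied to \<open>I\<close> tend to zero, which yields a matrix \<open>Z\<close> with \<open>I + L Z \<le> Z\<close>, and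
  \<open>P\<^sub>T \<le> c Z\<close> for some \<open>c\<close>
  (\<open>lyapunov_matrix\<close>, \<open>value_iter_bounded\<close>). The limit \<open>P\<close> satisfies \<open>P \<le> Q + F P\<close> by monotonicity.
  For the converse, \<open>P\<^sub>T \<ge> c P\<close> for large \<open>T\<close> if \<open>c < 1\<close>, and \<open>F (c P) \<ge> c F P\<close>, so \<open>P \<ge> Q + c F P\<close>
  for every \<open>c < 1\<close>.
\<close>

section \<open>Quadratic forms and inverses of positive definite matrices\<close>

text \<open>Adjoints are moved across inner products with \<open>inner_transpose_left\<close> and
  \<open>inner_transpose_right\<close>, so products with a transpose are kept as they are.\<close>

declare transpose_matrix_vector [simp del]

text \<open>The quadratic form of a matrix.\<close>

definition quad :: "real^'a^'a \<Rightarrow> real^'a \<Rightarrow> real" where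
  "quad Y x = x \<bullet> (Y *v x)"

text \<open>The cone of symmetric positive semidefinite matrices.\<close>

definition psd :: "real^'a^'a \<Rightarrow> bool" where
  "psd Y \<longleftrightarrow> transpose Y = Y \<and> (\<forall>x. 0 \<le> quad Y x)"

lemma inner_transpose_left: "(transpose A *v x) \<bullet> y = x \<bullet> (A *v (y::real^'b))"
  by (simp add: transpose_matrix_vector dot_lmul_matrix)

lemma inner_transpose_right: "x \<bullet> (transpose A *v y) = (A *v (x::real^'b)) \<bullet> y"
  by (metis inner_commute inner_transpose_left)

lemma transpose_add: "transpose (A + B) = transpose A + transpose (B::'a::plus^'n^'m)"
  by (simp add: transpose_def vec_eq_iff)

lemma transpose_diff: "transpose (A - B) = transpose A - transpose (B::'a::minus^'n^'m)"
  by (simp add: transpose_def vec_eq_iff)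

lemma transpose_sum: "transpose (\<Sum>i\<in>I. f i) = (\<Sum>i\<in>I. transpose (f i :: real^'n^'m))"
  by (simp add: transpose_def vec_eq_iff)

lemma matrix_sum_vector_mult: "(\<Sum>i\<in>I. f i) *v x = (\<Sum>i\<in>I. f i *v (x::real^'n))"
  by (induction I rule: infinite_finite_induct) (simp_all add: matrix_vector_mult_add_rdistrib)

lemma matrix_vector_mult_sum: "A *v (\<Sum>i\<in>I. f i) = (\<Sum>i\<in>I. A *v (f i::real^'n))"
  by (induction I rule: infinite_finite_induct) (simp_all add: matrix_vector_right_distrib)

lemma sym_inner: "transpose Y = Y \<Longrightarrow> x \<bullet> (Y *v y) = y \<bullet> (Y *v (x::real^'n))"
  by (metis inner_commute inner_transpose_right)

lemma quad_add: "quad (Y + Z) x = quad Y x + quad Z x"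
  by (simp add: quad_def algebra_simps)

lemma quad_diff: "quad (Y - Z) x = quad Y x - quad Z x"
  by (simp add: quad_def algebra_simps)

lemma quad_scaleR: "quad (c *\<^sub>R Y) x = c * quad Y x"
  by (simp add: quad_def scaleR_matrix_vector_assoc[symmetric])

lemma quad_sum: "quad (\<Sum>i\<in>I. f i) x = (\<Sum>i\<in>I. quad (f i) x)"
  by (simp add: quad_def matrix_sum_vector_mult inner_sum_right)

lemma quad_zero_mat [simp]: "quad 0 x = 0" and quad_zero_vec [simp]: "quad Y 0 = 0"
  by (simp_all add: quad_def)

lemma quad_mat_1 [simp]: "quad (mat 1) x = x \<bullet> x"
  by (simp add: quad_def)

lemma quad_congruence: "quad (transpose F ** Y ** F) x = quad Y (F *v x)"
  by (simp add: quad_def matrix_vector_mul_assoc[symmetric] inner_transpose_right)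

lemma quad_plus_vec:
  "transpose Y = Y \<Longrightarrow> quad Y (x + y) = quad Y x + 2 * (x \<bullet> (Y *v y)) + quad Y y"
  using sym_inner[of Y y x] by (simp add: quad_def algebra_simps inner_add_left inner_add_right)

lemma quad_scaleR_vec: "quad Y (c *\<^sub>R x) = c\<^sup>2 * quad Y x"
  by (simp add: quad_def matrix_vector_mult_scaleR power2_eq_square)

lemma entry_eq_inner: "(Y::real^'n^'m) $ a $ b = axis a 1 \<bullet> (Y *v axis b 1)"
  by (simp add: inner_axis' matrix_vector_mul_component inner_axis)

text \<open>Polarization: a symmetric matrix is determined by its quadratic form.\<close>

lemma entry_eq_quad:
  assumes "transpose Y = Y"
  shows "Y $ a $ b = (quad Y (axis a 1 + axis b 1) - quad Y (axis a 1) - quad Y (axis b 1)) / 2"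
  using assms by (simp add: quad_plus_vec entry_eq_inner)

lemma sym_mat_eqI:
  assumes "transpose Y = Y" "transpose Z = Z" "\<And>x. quad Y x = quad Z x"
  shows "Y = Z"
  unfolding vec_eq_iff using assms by (simp only: entry_eq_quad) simp

lemma psd_transpose: "psd Y \<Longrightarrow> transpose Y = Y" and psd_quad_nonneg: "psd Y \<Longrightarrow> 0 \<le> quad Y x"
  by (auto simp: psd_def)

lemma sym_pos_def_quad: "sym_pos_def Y \<longleftrightarrow> transpose Y = Y \<and> (\<forall>x. x \<noteq> 0 \<longrightarrow> 0 < quad Y x)"
  by (simp add: sym_pos_def_def quad_def)

lemma sym_pos_def_imp_psd: "sym_pos_def Y \<Longrightarrow> psd Y"
  unfolding sym_pos_def_quad psd_def by (metis less_eq_real_def quad_zero_vec)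

lemma quad_le_entries: "\<bar>quad Y x\<bar> \<le> (\<Sum>a\<in>UNIV. \<Sum>b\<in>UNIV. \<bar>Y $ a $ b\<bar>) * (x \<bullet> x)"
proof -
  have "quad Y x = (\<Sum>a\<in>UNIV. \<Sum>b\<in>UNIV. Y $ a $ b * (x $ a * x $ b))"
    by (simp add: quad_def inner_vec_def matrix_vector_mult_def sum_distrib_left ac_simps)
  also have "\<bar>\<dots>\<bar> \<le> (\<Sum>a\<in>UNIV. \<Sum>b\<in>UNIV. \<bar>Y $ a $ b * (x $ a * x $ b)\<bar>)"
    by (intro order_trans[OF sum_abs] sum_mono sum_abs)
  also have "\<dots> \<le> (\<Sum>a\<in>UNIV. \<Sum>b\<in>UNIV. \<bar>Y $ a $ b\<bar> * (x \<bullet> x))"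
  proof (intro sum_mono)
    fix a b
    have "\<bar>x $ a * x $ b\<bar> \<le> norm x * norm x"
      unfolding abs_mult by (intro mult_mono component_le_norm_cart) auto
    also have "\<dots> = x \<bullet> x" by (metis dot_square_norm power2_eq_square)
    finally show "\<bar>Y $ a $ b * (x $ a * x $ b)\<bar> \<le> \<bar>Y $ a $ b\<bar> * (x \<bullet> x)"
      by (metis abs_ge_zero abs_mult mult_left_mono)
  qed
  finally show ?thesis by (simp add: sum_distrib_right)
qed

lemma quad_upper: "\<exists>c\<ge>0. \<forall>x. quad Y x \<le> c * (x \<bullet> x)"
  by (rule exI[of _ "\<Sum>a\<in>UNIV. \<Sum>b\<in>UNIV. \<bar>Y $ a $ b\<bar>"])
     (use quad_le_entries[of Y] in \<open>auto simp: abs_le_iff intro!: sum_nonneg\<close>)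

lemma continuous_on_quad [continuous_intros]: "continuous_on S (quad Y)"
  unfolding quad_def by (intro continuous_intros)

lemma quad_lower:
  fixes Y :: "real^'n^'n"
  assumes "sym_pos_def Y"
  shows "\<exists>d>0. \<forall>x. d * (x \<bullet> x) \<le> quad Y x"
proof -
  let ?S = "sphere (0::real^'n) 1"
  obtain i :: 'n where True by simp
  have "axis i 1 \<in> ?S" by simp
  then have "?S \<noteq> {}" by blast
  then obtain z where z: "z \<in> ?S" "\<And>y. y \<in> ?S \<Longrightarrow> quad Y z \<le> quad Y y"
    using continuous_attains_inf[OF compact_sphere _ continuous_on_quad] by blast
  have "quad Y z * (x \<bullet> x) \<le> quad Y x" for x
  proof (cases "x = 0")
    case False
    then have "quad Y z \<le> quad Y ((1 / norm x) *\<^sub>R x)" by (intro z) simp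
    then have "quad Y z \<le> quad Y x / (norm x)\<^sup>2" by (simp add: quad_scaleR_vec power_divide)
    with False show ?thesis by (simp add: dot_square_norm field_simps)
  qed simp
  moreover have "z \<noteq> 0" using z(1) by auto
  then have "0 < quad Y z" using assms by (simp add: sym_pos_def_quad)
  ultimately show ?thesis by blast
qed

lemma inverse_matrix_exists:
  fixes W :: "real^'n^'n"
  assumes "sym_pos_def W"
  shows "\<exists>V. W ** V = mat 1 \<and> V ** W = mat 1"
proof -
  have "inj ((*v) W)"
  proof (rule injI)
    fix x y assume "W *v x = W *v y"
    then have "quad W (x - y) = 0" by (simp add: quad_def matrix_vector_mult_diff_distrib)
    then show "x = y" using assms unfolding sym_pos_def_quad by (metis less_irrefl right_minus_eq)
  qed
  then show ?thesis by (metis matrix_left_invertible_injective matrix_left_right_inverse)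
qed

text \<open>Multiplication by \<open>mat_on I\<close> projects onto the coordinates in \<open>I\<close>.\<close>

lemma mat_on_entry_mult:
  "(mat_on I ** (X::real^'b^'a)) $ a $ b = (if a \<in> I then X $ a $ b else 0)"
  "((Z::real^'a^'b) ** mat_on I) $ b $ a = (if a \<in> I then Z $ b $ a else 0)"
proof -
  have "(mat_on I ** X) $ a $ b = (\<Sum>k\<in>UNIV. if k = a then (if a \<in> I then X $ a $ b else 0) else 0)"
    unfolding matrix_matrix_mult_def vec_lambda_beta by (intro sum.cong) (auto simp: mat_on_def)
  then show "(mat_on I ** X) $ a $ b = (if a \<in> I then X $ a $ b else 0)" by simp
  have "(Z ** mat_on I) $ b $ a = (\<Sum>k\<in>UNIV. if k = a then (if a \<in> I then Z $ b $ a else 0) else 0)"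
    unfolding matrix_matrix_mult_def vec_lambda_beta by (intro sum.cong) (auto simp: mat_on_def)
  then show "(Z ** mat_on I) $ b $ a = (if a \<in> I then Z $ b $ a else 0)" by simp
qed

lemma mat_on_vec: "(mat_on I *v (x::real^'a)) $ a = (if a \<in> I then x $ a else 0)"
proof -
  have "(mat_on I *v x) $ a = (\<Sum>k\<in>UNIV. if k = a then (if a \<in> I then x $ a else 0) else 0)"
    unfolding matrix_vector_mult_def vec_lambda_beta by (intro sum.cong) (auto simp: mat_on_def)
  then show ?thesis by simp
qed

text \<open>If \<open>W\<close> is padded with zeros outside \<open>I \<times> I\<close> and positive definite on the vectors supported in
  \<open>I\<close>, then \<open>W + mat_on (- I)\<close> is positive definite on the whole space, and the compression of its
  inverse to \<open>I\<close> is the padded inverse of \<open>W\<close>.\<close>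

lemma inv_on_works:
  fixes W :: "real^'m^'m"
  assumes sym: "transpose W = W"
    and supp: "\<And>a b. \<not> (a \<in> I \<and> b \<in> I) \<Longrightarrow> W $ a $ b = 0"
    and pos: "\<And>x. x \<noteq> 0 \<Longrightarrow> (\<And>a. a \<notin> I \<Longrightarrow> x $ a = 0) \<Longrightarrow> 0 < quad W x"
  shows "W ** inv_on I W = mat_on I" "transpose (inv_on I W) = inv_on I W"
    "a \<notin> I \<Longrightarrow> inv_on I W $ a $ b = 0"
proof -
  let ?E = "mat_on I :: real^'m^'m" and ?E' = "mat_on (- I) :: real^'m^'m"
  define W1 where "W1 = W + ?E'"
  have E: "?E ** W1 = W" "W1 ** ?E = W" "?E ** ?E = ?E" "W ** ?E = W" "?E ** W = W"
    using supp by (auto simp: vec_eq_iff mat_on_entry_mult W1_def) (auto simp: mat_on_def)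
  have tE: "transpose ?E = ?E" "transpose ?E' = ?E'"
    by (auto simp: mat_on_def transpose_def vec_eq_iff)
  have split: "quad W1 x = quad W (?E *v x) + (?E' *v x) \<bullet> (?E' *v x)" for x
  proof -
    have "quad W (?E *v x) = quad (transpose ?E ** W ** ?E) x"
      by (simp only: quad_congruence)
    also have "\<dots> = quad W x" by (simp add: tE E)
    finally have *: "quad W (?E *v x) = quad W x" .
    have "(?E' *v x) \<bullet> (?E' *v x) = x \<bullet> (?E' *v (?E' *v x))"
      by (metis inner_transpose_right tE(2))
    also have "?E' *v (?E' *v x) = ?E' *v x"
      by (simp add: vec_eq_iff mat_on_vec)
    finally have "(?E' *v x) \<bullet> (?E' *v x) = quad ?E' x" by (simp add: quad_def)
    then show ?thesis by (simp add: W1_def quad_add *)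
  qed
  have "0 < quad W1 x" if "x \<noteq> 0" for x
  proof (cases "?E *v x = 0")
    case True
    then have "?E' *v x = x" by (auto simp: vec_eq_iff mat_on_vec split: if_splits)
    with True that show ?thesis by (simp add: split)
  next
    case False
    then have "0 < quad W (?E *v x)" by (rule pos) (simp add: mat_on_vec)
    then show ?thesis by (simp add: split add_pos_nonneg)
  qed
  moreover have tW1: "transpose W1 = W1" by (simp add: W1_def transpose_add sym tE)
  ultimately have "sym_pos_def W1" by (simp add: sym_pos_def_quad)
  then obtain V where V: "W1 ** V = mat 1" "V ** W1 = mat 1"
    using inverse_matrix_exists by blast
  have tV: "transpose V = V"
    by (metis V tW1 matrix_mul_assoc matrix_mul_lid matrix_mul_rid matrix_transpose_mul transpose_mat)
  have WV: "W ** V = ?E" "V ** W = ?E"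
    using E V by (metis matrix_mul_assoc matrix_mul_rid, metis matrix_mul_assoc matrix_mul_lid)
  define V' where "V' = ?E ** V ** ?E"
  have supp': "\<not> (a \<in> I \<and> b \<in> I) \<Longrightarrow> V' $ a $ b = 0" for a b
    by (auto simp: V'_def mat_on_entry_mult)
  have right: "W ** V' = ?E"
    unfolding V'_def using E WV by (metis matrix_mul_assoc)
  have left: "V' ** W = ?E"
    unfolding V'_def using E WV by (metis matrix_mul_assoc)
  have inv: "inv_on I W = V'"
    by (intro inv_on_eqI supp' right left)
  show "W ** inv_on I W = mat_on I" by (simp add: inv right)
  show "transpose (inv_on I W) = inv_on I W"
    unfolding inv by (simp add: V'_def matrix_transpose_mul tE tV matrix_mul_assoc)
  show "a \<notin> I \<Longrightarrow> inv_on I W $ a $ b = 0"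
    by (simp add: inv supp')
qed

lemma matrix_inv_works:
  fixes W :: "real^'m^'m"
  assumes "sym_pos_def W"
  shows "W ** matrix_inv W = mat 1" "transpose (matrix_inv W) = matrix_inv W"
proof -
  have m: "mat_on UNIV = (mat 1 :: real^'m^'m)" by (simp add: mat_on_def mat_def)
  from inv_on_works[of W UNIV] assms
  show "W ** matrix_inv W = mat 1" "transpose (matrix_inv W) = matrix_inv W"
    by (auto simp: sym_pos_def_quad inv_on_UNIV m)
qed

lemma transpose_riccati_on:
  fixes A P :: "real^'n^'n" and B :: "real^'m^'n"
  assumes "transpose P = P"
    and "transpose (inv_on I (R + transpose B ** P ** B)) = inv_on I (R + transpose B ** P ** B)"
  shows "transpose (riccati_on I A P B R) = riccati_on I A P B R"
  using assms
  by (simp add: riccati_on_def matrix_transpose_mul transpose_diff matrix_mul_assoc)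

lemma quad_riccati_on:
  "quad (riccati_on I A P B R) x = (A *v x) \<bullet> (P *v (A *v x -
     B *v ((inv_on I (R + transpose B ** P ** B) ** transpose B ** P) *v (A *v x))))"
  by (simp add: quad_def riccati_on_def matrix_vector_mul_assoc[symmetric] inner_transpose_right
      matrix_vector_mult_diff_distrib matrix_vector_mult_diff_rdistrib inner_diff_right)

lemma psd_zero: "psd 0"
  by (simp add: psd_def transpose_def vec_eq_iff)

lemma psd_add: "psd Y \<Longrightarrow> psd Z \<Longrightarrow> psd (Y + Z)"
  by (simp add: psd_def transpose_add quad_add)

lemma psd_scaleR: "psd Y \<Longrightarrow> 0 \<le> c \<Longrightarrow> psd (c *\<^sub>R Y)"
  by (simp add: psd_def transpose_scalar quad_scaleR)

lemma psd_sum: "(\<And>i. i \<in> I \<Longrightarrow> psd (f i)) \<Longrightarrow> psd (\<Sum>i\<in>I. f i)"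
  by (simp add: psd_def transpose_sum quad_sum sum_nonneg)

lemma psd_mat_1: "psd (mat 1)"
  by (simp add: psd_def)

text \<open>Restricting any generalized inverse of a block diagonal matrix to the diagonal blocks gives a
  generalized inverse that is itself block diagonal.\<close>

lemma block_diagonal_generalized_inverse:
  fixes B :: "real^'m::finite^'n::finite"
  assumes "block_diagonal f g B"
  obtains G where "block_diagonal g f G" "B ** G ** B = B"
proof -
  obtain h where h: "linear h" "\<And>v. B *v (h (B *v v)) = B *v v"
    using linear_exists_right_inverse_on[OF matrix_vector_mul_linear[of B] subspace_UNIV] by auto
  define H where "H = matrix h"
  have "B ** H ** B = B"
    by (simp add: matrix_eq H_def matrix_vector_mul_assoc[symmetric] matrix_works[OF h(1)[folded linear_matrix_vector_mul_eq]] h(2))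
  then have BHB: "(\<Sum>b\<in>UNIV. (\<Sum>c\<in>UNIV. B $ a $ c * H $ c $ b) * B $ b $ d) = B $ a $ d" for a d
    by (simp add: matrix_matrix_mult_def vec_eq_iff)
  define G where "G = (\<chi> c b. if g c = f b then H $ c $ b else 0)"
  have B0: "f a = g c" if "B $ a $ c \<noteq> 0" for a c
    using assms that by (auto simp: block_diagonal_def)
  have "(\<Sum>b\<in>UNIV. (\<Sum>c\<in>UNIV. B $ a $ c * G $ c $ b) * B $ b $ d) = B $ a $ d" for a d
  proof (cases "f a = g d")
    case True
    have eq: "B $ a $ c * G $ c $ b * B $ b $ d = B $ a $ c * H $ c $ b * B $ b $ d" for b c
      using B0[of a c] B0[of b d] True by (cases "B $ a $ c = 0 \<or> B $ b $ d = 0") (auto simp: G_def)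
    show ?thesis using BHB[of a d] unfolding sum_distrib_right by (simp only: eq)
  next
    case False
    have zero: "B $ a $ c * G $ c $ b * B $ b $ d = 0" for b c
      using B0[of a c] B0[of b d] False by (cases "B $ a $ c = 0 \<or> B $ b $ d = 0") (auto simp: G_def)
    have "B $ a $ d = 0" using B0[of a d] False by blast
    then show ?thesis unfolding sum_distrib_right by (simp only: zero sum.neutral_const)
  qed
  then have "B ** G ** B = B" by (simp add: matrix_matrix_mult_def vec_eq_iff)
  moreover have "block_diagonal g f G" by (simp add: block_diagonal_def G_def)
  ultimately show thesis using that by blast
qed

section \<open>Measurability and limits of matrix-valued functions\<close>

lemma vec_eq_sum_axis: "(x::'a::real_normed_vector^'n) = (\<Sum>a\<in>UNIV. axis a (x $ a))"
proof -
  have "(\<Sum>a\<in>UNIV. axis a (x $ a)) $ b = (\<Sum>a\<in>UNIV. if a = b then x $ b else 0)" for b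
    unfolding sum_component by (intro sum.cong) (auto simp: axis_def)
  then show ?thesis by (simp add: vec_eq_iff)
qed

lemma bounded_linear_axis: "bounded_linear (axis a :: 'a::euclidean_space \<Rightarrow> 'a^'n)"
  unfolding linear_conv_bounded_linear[symmetric]
  by (rule linearI) (auto simp: axis_def vec_eq_iff)

lemma borel_measurable_bounded_linear:
  "bounded_linear L \<Longrightarrow> f \<in> borel_measurable M \<Longrightarrow> (\<lambda>\<omega>. L (f \<omega>)) \<in> borel_measurable M"
  by (rule measurable_compose[OF _ borel_measurable_continuous_onI[OF linear_continuous_on]])

lemma borel_measurable_vec_nth [measurable (raw)]:
  fixes f :: "'w \<Rightarrow> 'a::euclidean_space^'n"
  shows "f \<in> borel_measurable M \<Longrightarrow> (\<lambda>\<omega>. f \<omega> $ a) \<in> borel_measurable M"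
  by (rule borel_measurable_bounded_linear[OF bounded_linear_vec_nth])

lemma borel_measurable_vecI:
  fixes f :: "'w \<Rightarrow> 'a::euclidean_space^'n"
  assumes "\<And>a. (\<lambda>\<omega>. f \<omega> $ a) \<in> borel_measurable M"
  shows "f \<in> borel_measurable M"
proof -
  have "(\<lambda>\<omega>. \<Sum>a\<in>UNIV. axis a (f \<omega> $ a)) \<in> borel_measurable M"
    by (intro borel_measurable_sum borel_measurable_bounded_linear[OF bounded_linear_axis] assms)
  then show ?thesis by (simp only: vec_eq_sum_axis[symmetric])
qed

lemma integrable_vecI:
  fixes f :: "'w \<Rightarrow> 'a::euclidean_space^'n"
  assumes "\<And>a. integrable M (\<lambda>\<omega>. f \<omega> $ a)"
  shows "integrable M f"
proof -
  have "integrable M (\<lambda>\<omega>. \<Sum>a\<in>UNIV. axis a (f \<omega> $ a))"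
    by (intro Bochner_Integration.integrable_sum integrable_bounded_linear[OF bounded_linear_axis] assms)
  then show ?thesis by (simp only: vec_eq_sum_axis[symmetric])
qed

lemma borel_measurable_quad [measurable (raw)]:
  "f \<in> borel_measurable M \<Longrightarrow> (\<lambda>\<omega>. quad Y (f \<omega>)) \<in> borel_measurable M"
  by (rule measurable_compose[OF _ borel_measurable_continuous_onI[OF continuous_on_quad]])

lemma bounded_linear_matrix_vector_mult_left: "bounded_linear (\<lambda>S::real^'n^'m. S *v x)"
  unfolding linear_conv_bounded_linear[symmetric]
  by (rule linearI) (simp_all add: algebra_simps scaleR_matrix_vector_assoc)

lemma borel_measurable_matrix_vector_mult [measurable (raw)]:
  fixes F :: "'w \<Rightarrow> real^'n^'m"
  assumes [measurable]: "F \<in> borel_measurable M" "f \<in> borel_measurable M"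
  shows "(\<lambda>\<omega>. F \<omega> *v f \<omega>) \<in> borel_measurable M"
  by (rule borel_measurable_vecI) (simp add: matrix_vector_mult_def)

lemma borel_measurable_matrix_matrix_mult [measurable (raw)]:
  fixes F :: "'w \<Rightarrow> real^'n^'m" and G :: "'w \<Rightarrow> real^'k^'n"
  assumes [measurable]: "F \<in> borel_measurable M" "G \<in> borel_measurable M"
  shows "(\<lambda>\<omega>. F \<omega> ** G \<omega>) \<in> borel_measurable M"
  by (intro borel_measurable_vecI) (simp add: matrix_matrix_mult_def)

lemma bounded_linear_block_row: "bounded_linear (block_row f i :: real^'b^'a \<Rightarrow> real^'b^'a)"
  unfolding linear_conv_bounded_linear[symmetric]
  by (rule linearI) (auto simp: block_row_def vec_eq_iff)

lemma block_row_diff: "block_row f i (S - T) = block_row f i S - block_row f i (T::real^'b^'a)"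
  by (simp add: bounded_linear.linear[OF bounded_linear_block_row] linear_diff)

lemma borel_measurable_block_row [measurable (raw)]:
  fixes F :: "'w \<Rightarrow> real^'b^'a"
  shows "F \<in> borel_measurable M \<Longrightarrow> (\<lambda>\<omega>. block_row f i (F \<omega>)) \<in> borel_measurable M"
  by (rule borel_measurable_bounded_linear[OF bounded_linear_block_row])

lemma sum_block_row: "(\<Sum>i\<in>UNIV. block_row f i S) = (S::real^'b^'a)" for f :: "'a::finite \<Rightarrow> 's::finite"
  by (simp add: block_row_def vec_eq_iff)

lemma block_col_eq: "block_col g i B = B ** mat_on {c. g c = i}"
  by (auto simp: vec_eq_iff mat_on_entry_mult block_col_def)

lemma diag_block_eq: "diag_block g i R = mat_on {c. g c = i} ** R ** mat_on {c. g c = i}"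
  by (auto simp: vec_eq_iff mat_on_entry_mult diag_block_def)

lemma transpose_mat_on: "transpose (mat_on I) = mat_on I"
  by (auto simp: mat_on_def transpose_def vec_eq_iff)

lemma bounded_linear_matrix_mult: "bounded_linear (\<lambda>Y::real^'k^'n. (G::real^'n^'m) ** Y)"
  unfolding linear_conv_bounded_linear[symmetric]
  by (rule linearI) (simp_all add: matrix_add_ldistrib matrix_scalar_ac scalar_matrix_assoc)

lemma bounded_linear_quad: "bounded_linear (\<lambda>Y. quad Y x)"
  unfolding linear_conv_bounded_linear[symmetric]
  by (rule linearI) (simp_all add: quad_add quad_scaleR)

lemma bounded_linear_transpose: "bounded_linear (transpose :: real^'n^'m \<Rightarrow> real^'m^'n)"
  unfolding linear_conv_bounded_linear[symmetric]
  by (rule linearI) (simp_all add: transpose_add transpose_scalar)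

text \<open>By polarization, pointwise convergence of the quadratic forms is enough.\<close>

lemma sym_mat_convergent:
  fixes Y :: "nat \<Rightarrow> real^'n^'n"
  assumes sym: "\<And>k. transpose (Y k) = Y k" and conv: "\<And>x. convergent (\<lambda>k. quad (Y k) x)"
  shows "\<exists>Z. Y \<longlonglongrightarrow> Z"
proof -
  have "convergent (\<lambda>k. Y k $ a $ b)" for a b
    unfolding entry_eq_quad[OF sym] divide_inverse
    by (intro convergent_mult convergent_diff conv convergent_const)
  then have *: "(\<lambda>k. Y k $ a $ b) \<longlonglongrightarrow> lim (\<lambda>k. Y k $ a $ b)" for a b
    by (simp add: convergent_LIMSEQ_iff)
  have "Y \<longlonglongrightarrow> (\<chi> a b. lim (\<lambda>k. Y k $ a $ b))"
    by (intro vec_tendstoI) (simp add: *)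
  then show ?thesis by blast
qed

lemma tendsto_quad: "Y \<longlonglongrightarrow> Z \<Longrightarrow> (\<lambda>k. quad (Y k) x) \<longlonglongrightarrow> quad Z x"
  by (rule bounded_linear.tendsto[OF bounded_linear_quad])

lemma tendsto_entries:
  fixes Y :: "nat \<Rightarrow> real^'n^'n"
  assumes "Y \<longlonglongrightarrow> 0"
  shows "(\<lambda>k. \<Sum>a\<in>UNIV. \<Sum>b\<in>UNIV. \<bar>Y k $ a $ b\<bar>) \<longlonglongrightarrow> 0"
proof -
  have "(\<lambda>k. \<Sum>a\<in>UNIV. \<Sum>b\<in>UNIV. \<bar>Y k $ a $ b\<bar>) \<longlonglongrightarrow> (\<Sum>a\<in>UNIV. \<Sum>b\<in>UNIV. \<bar>(0::real^'n^'n) $ a $ b\<bar>)"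
    by (intro tendsto_sum tendsto_rabs tendsto_vec_nth assms)
  then show ?thesis by simp
qed

text \<open>The bound is uniform in \<open>x\<close>, which is what separates it from \<open>tendsto_quad\<close>.\<close>

lemma eventually_quad_small:
  fixes Y :: "nat \<Rightarrow> real^'n^'n"
  assumes "Y \<longlonglongrightarrow> 0" "0 < e"
  shows "eventually (\<lambda>k. \<forall>x. quad (Y k) x \<le> e * (x \<bullet> x)) sequentially"
proof (rule eventually_mono)
  show "eventually (\<lambda>k. (\<Sum>a\<in>UNIV. \<Sum>b\<in>UNIV. \<bar>Y k $ a $ b\<bar>) < e) sequentially"
    using order_tendstoD(2)[OF tendsto_entries[OF assms(1)] assms(2)] .
  fix k assume k: "(\<Sum>a\<in>UNIV. \<Sum>b\<in>UNIV. \<bar>Y k $ a $ b\<bar>) < e"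
  show "\<forall>x. quad (Y k) x \<le> e * (x \<bullet> x)"
  proof
    fix x
    have "quad (Y k) x \<le> (\<Sum>a\<in>UNIV. \<Sum>b\<in>UNIV. \<bar>Y k $ a $ b\<bar>) * (x \<bullet> x)"
      using quad_le_entries[of "Y k" x] by linarith
    also have "\<dots> \<le> e * (x \<bullet> x)" using k by (intro mult_right_mono) simp_all
    finally show "quad (Y k) x \<le> e * (x \<bullet> x)" .
  qed
qed

section \<open>Square integrable random vectors and matrices\<close>

text \<open>On matrices the inner product is the entrywise one, so this says that all entries have finite
  second moments.\<close>

definition sq_integrable :: "'w measure \<Rightarrow> ('w \<Rightarrow> 'a::euclidean_space) \<Rightarrow> bool" where
  "sq_integrable M f \<longleftrightarrow> f \<in> borel_measurable M \<and> integrable M (\<lambda>\<omega>. f \<omega> \<bullet> f \<omega>)"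

lemma sq_integrable_measurable: "sq_integrable M f \<Longrightarrow> f \<in> borel_measurable M"
  by (simp add: sq_integrable_def)

lemma sq_integrable_inner:
  fixes f g :: "'w \<Rightarrow> 'a::euclidean_space"
  assumes "sq_integrable M f" "sq_integrable M g"
  shows "integrable M (\<lambda>\<omega>. f \<omega> \<bullet> g \<omega>)"
proof (rule Bochner_Integration.integrable_bound)
  show "integrable M (\<lambda>\<omega>. f \<omega> \<bullet> f \<omega> + g \<omega> \<bullet> g \<omega>)"
    using assms by (simp add: sq_integrable_def)
  show "(\<lambda>\<omega>. f \<omega> \<bullet> g \<omega>) \<in> borel_measurable M"
    using assms by (intro borel_measurable_inner) (simp_all add: sq_integrable_def)
  have "\<bar>x \<bullet> y\<bar> \<le> x \<bullet> x + y \<bullet> y" for x y :: 'a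
  proof -
    have "0 \<le> (x + y) \<bullet> (x + y)" "0 \<le> (x - y) \<bullet> (x - y)" by simp_all
    then have "\<bar>2 * (x \<bullet> y)\<bar> \<le> x \<bullet> x + y \<bullet> y"
      by (simp add: inner_add_left inner_add_right inner_diff_left inner_diff_right inner_commute abs_le_iff)
    then show ?thesis by linarith
  qed
  then have "norm (f \<omega> \<bullet> g \<omega>) \<le> norm (f \<omega> \<bullet> f \<omega> + g \<omega> \<bullet> g \<omega>)" for \<omega>
    unfolding real_norm_def by (rule order_trans[OF _ abs_ge_self])
  then show "AE \<omega> in M. norm (f \<omega> \<bullet> g \<omega>) \<le> norm (f \<omega> \<bullet> f \<omega> + g \<omega> \<bullet> g \<omega>)"
    by blast
qed

lemma sq_integrable_linear:
  assumes L: "bounded_linear L" and f: "sq_integrable M f"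
  shows "sq_integrable M (\<lambda>\<omega>. L (f \<omega>))"
proof -
  obtain K where K: "\<And>x. norm (L x) \<le> norm x * K" using bounded_linear.bounded[OF L] by blast
  have *: "(\<lambda>\<omega>. L (f \<omega>)) \<in> borel_measurable M"
    using f by (intro borel_measurable_bounded_linear[OF L]) (simp add: sq_integrable_def)
  have "integrable M (\<lambda>\<omega>. (f \<omega> \<bullet> f \<omega>) * K\<^sup>2)"
    using f by (simp add: sq_integrable_def)
  then have "integrable M (\<lambda>\<omega>. L (f \<omega>) \<bullet> L (f \<omega>))"
  proof (rule Bochner_Integration.integrable_bound)
    show "(\<lambda>\<omega>. L (f \<omega>) \<bullet> L (f \<omega>)) \<in> borel_measurable M"
      by (intro borel_measurable_inner *)
    have "L x \<bullet> L x \<le> (x \<bullet> x) * K\<^sup>2" for x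
      unfolding dot_square_norm power_mult_distrib[symmetric] by (intro power_mono K) simp
    then show "AE \<omega> in M. norm (L (f \<omega>) \<bullet> L (f \<omega>)) \<le> norm ((f \<omega> \<bullet> f \<omega>) * K\<^sup>2)"
      by simp
  qed
  with * show ?thesis by (simp add: sq_integrable_def)
qed

lemma sq_integrable_add:
  assumes "sq_integrable M f" "sq_integrable M g"
  shows "sq_integrable M (\<lambda>\<omega>. f \<omega> + g \<omega>)"
  using assms sq_integrable_inner[OF assms]
  by (auto simp: sq_integrable_def inner_add_left inner_add_right inner_commute intro!: borel_measurable_add)

lemma sq_integrable_diff:
  assumes "sq_integrable M f" "sq_integrable M g"
  shows "sq_integrable M (\<lambda>\<omega>. f \<omega> - g \<omega>)"
  using assms sq_integrable_inner[OF assms]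
  by (auto simp: sq_integrable_def inner_diff_left inner_diff_right inner_commute intro!: borel_measurable_diff)

lemma sq_integrable_zero: "sq_integrable M (\<lambda>_. 0)"
  by (simp add: sq_integrable_def)

lemma sq_integrable_sum:
  "(\<And>i. i \<in> I \<Longrightarrow> sq_integrable M (f i)) \<Longrightarrow> sq_integrable M (\<lambda>\<omega>. \<Sum>i\<in>I. f i \<omega>)"
  by (induction I rule: infinite_finite_induct)
     (simp_all add: sq_integrable_zero sq_integrable_add)

lemma sq_integrable_vecI:
  fixes f :: "'w \<Rightarrow> 'a::euclidean_space^'n"
  assumes "\<And>a. sq_integrable M (\<lambda>\<omega>. f \<omega> $ a)"
  shows "sq_integrable M f"
proof -
  have "sq_integrable M (\<lambda>\<omega>. \<Sum>a\<in>UNIV. axis a (f \<omega> $ a))"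
    by (intro sq_integrable_sum sq_integrable_linear[OF bounded_linear_axis] assms)
  then show ?thesis by (simp only: vec_eq_sum_axis[symmetric])
qed

lemma (in finite_measure) sq_integrable_const: "sq_integrable M (\<lambda>_. c)"
  by (simp add: sq_integrable_def)

lemma (in finite_measure) sq_integrable_imp_integrable:
  fixes f :: "'a \<Rightarrow> 'b::euclidean_space"
  assumes "sq_integrable M f"
  shows "integrable M f"
proof -
  have "integrable M (\<lambda>\<omega>. (f \<omega> \<bullet> b) *\<^sub>R b)" if "b \<in> Basis" for b
    using sq_integrable_inner[OF assms sq_integrable_const] by simp
  then have "integrable M (\<lambda>\<omega>. \<Sum>b\<in>Basis. (f \<omega> \<bullet> b) *\<^sub>R b)" by simp
  then show ?thesis by (simp add: euclidean_representation)
qed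

lemma sq_integrable_quad: "sq_integrable M f \<Longrightarrow> integrable M (\<lambda>\<omega>. quad Y (f \<omega>))"
  unfolding quad_def
  by (intro sq_integrable_inner sq_integrable_linear[OF matrix_vector_mul_bounded_linear])

lemma sq_integrable_mv: "sq_integrable M F \<Longrightarrow> sq_integrable M (\<lambda>\<omega>. (F \<omega> :: real^'n^'m) *v x)"
  by (rule sq_integrable_linear[OF bounded_linear_matrix_vector_mult_left])

lemma sq_integrable_vm: "sq_integrable M f \<Longrightarrow> sq_integrable M (\<lambda>\<omega>. Y *v f \<omega>)" for Y :: "real^'n^'m"
  by (rule sq_integrable_linear[OF matrix_vector_mul_bounded_linear])

text \<open>Entry \<open>(a, b)\<close> is the inner product of column \<open>a\<close> of \<open>F\<close> with \<open>Y\<close> times column \<open>b\<close>.\<close>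

lemma sq_integrable_congruence:
  fixes F :: "'w \<Rightarrow> real^'n^'m"
  assumes "sq_integrable M F"
  shows "integrable M (\<lambda>\<omega>. transpose (F \<omega>) ** Y ** F \<omega>)"
proof (intro integrable_vecI)
  fix a b
  have "(transpose (F \<omega>) ** Y ** F \<omega>) $ a $ b = (F \<omega> *v axis a 1) \<bullet> (Y *v (F \<omega> *v axis b 1))" for \<omega>
    by (simp add: entry_eq_inner matrix_vector_mul_assoc[symmetric] inner_transpose_right)
  then show "integrable M (\<lambda>\<omega>. (transpose (F \<omega>) ** Y ** F \<omega>) $ a $ b)"
    by (simp add: sq_integrable_inner sq_integrable_mv sq_integrable_vm assms)
qed

lemma quad_integral: "integrable M F \<Longrightarrow> quad (\<integral>\<omega>. F \<omega> \<partial>M) x = (\<integral>\<omega>. quad (F \<omega>) x \<partial>M)"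
  by (rule integral_bounded_linear[OF bounded_linear_quad, symmetric])

lemma transpose_integral: "integrable M F \<Longrightarrow> transpose (\<integral>\<omega>. F \<omega> \<partial>M) = (\<integral>\<omega>. transpose (F \<omega> :: real^'n^'m) \<partial>M)"
  by (rule integral_bounded_linear[OF bounded_linear_transpose, symmetric])

lemma sq_integrable_of_quad:
  assumes W: "sym_pos_def W" and f: "f \<in> borel_measurable M" and fin: "(\<integral>\<^sup>+\<omega>. ennreal (quad W (f \<omega>)) \<partial>M) < \<infinity>"
  shows "sq_integrable M f"
  unfolding sq_integrable_def
proof (intro conjI f)
  obtain d where d: "d > 0" "\<And>x. d * (x \<bullet> x) \<le> quad W x" using quad_lower[OF W] by blast
  have nn: "0 \<le> quad W x" for x using psd_quad_nonneg[OF sym_pos_def_imp_psd[OF W]] .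
  have meas: "(\<lambda>\<omega>. quad W (f \<omega>)) \<in> borel_measurable M" using f by measurable
  have "integrable M (\<lambda>\<omega>. quad W (f \<omega>))"
    using fin meas nn by (simp add: integrable_iff_bounded)
  then have "integrable M (\<lambda>\<omega>. quad W (f \<omega>) / d)" by simp
  then show "integrable M (\<lambda>\<omega>. f \<omega> \<bullet> f \<omega>)"
  proof (rule Bochner_Integration.integrable_bound)
    show "(\<lambda>\<omega>. f \<omega> \<bullet> f \<omega>) \<in> borel_measurable M" using f by (intro borel_measurable_inner)
    show "AE \<omega> in M. norm (f \<omega> \<bullet> f \<omega>) \<le> norm (quad W (f \<omega>) / d)"
      using d nn by (auto simp: field_simps)
  qed
qed

section \<open>Optimal decentralized input for one step\<close>

text \<open>A single transition \<open>x \<mapsto> X x + B u\<close> with a random matrix \<open>X\<close> whose row blocks are pairwise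
  independent.\<close>

locale random_step = prob_space M for M :: "'w measure" +
  fixes sx :: "'n::finite \<Rightarrow> 's::finite" and su :: "'m::finite \<Rightarrow> 's"
    and X :: "'w \<Rightarrow> real^'n^'n" and B :: "real^'m^'n" and R :: "real^'m^'m"
  assumes sq_X: "sq_integrable M X"
    and rows_indep: "i \<noteq> j \<Longrightarrow>
      indep_var borel (\<lambda>\<omega>. block_row sx i (X \<omega>)) borel (\<lambda>\<omega>. block_row sx j (X \<omega>))"
    and R_pos: "sym_pos_def R"
begin

definition mean :: "real^'n^'n" where
  "mean = (\<integral>\<omega>. X \<omega> \<partial>M)"

text \<open>The \<open>i\<close>-th centred row block.\<close>

definition dev :: "'s \<Rightarrow> 'w \<Rightarrow> real^'n^'n" where
  "dev i \<omega> = block_row sx i (X \<omega> - mean)"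

text \<open>Half the Hessian of the stage cost with respect to the full input, and its restriction to the input
  coordinates of subsystem \<open>i\<close>.\<close>

definition weight :: "real^'n^'n \<Rightarrow> real^'m^'m" where
  "weight P = R + transpose B ** P ** B"

definition local_weight :: "'s \<Rightarrow> real^'n^'n \<Rightarrow> real^'m^'m" where
  "local_weight i P = diag_block su i R + transpose (block_col su i B) ** P ** block_col su i B"

text \<open>The optimal input responds to the mean of the system matrix through \<open>mean_gain\<close> and to the
  deviation of row block \<open>i\<close> through \<open>local_gain i\<close>, whose values are supported on the coordinates of
  subsystem \<open>i\<close>.\<close>

definition mean_gain :: "real^'n^'n \<Rightarrow> real^'n^'m" where
  "mean_gain P = matrix_inv (weight P) ** transpose B ** P"

definition local_gain :: "'s \<Rightarrow> real^'n^'n \<Rightarrow> real^'n^'m" where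
  "local_gain i P = inv_on {c. su c = i} (local_weight i P) ** transpose (block_col su i B) ** P"

text \<open>The feedback of the theorem at the state \<open>x\<close>.\<close>

definition opt_input :: "real^'n^'n \<Rightarrow> real^'n \<Rightarrow> 'w \<Rightarrow> real^'m" where
  "opt_input P x \<omega> = - (mean_gain P *v (mean *v x)) - (\<Sum>i\<in>UNIV. local_gain i P *v (dev i \<omega> *v x))"

text \<open>The modified Riccati operator without the additive term \<open>Q\<close>.\<close>

definition riccati_map :: "real^'n^'n \<Rightarrow> real^'n^'n" where
  "riccati_map P = riccati mean P B R +
     (\<Sum>i\<in>UNIV. \<integral>\<omega>. riccati_on {c. su c = i} (dev i \<omega>) P (block_col su i B) (diag_block su i R) \<partial>M)"

text \<open>Coordinate \<open>c\<close> of the input is a measurable function of the row block of the subsystem to which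
  \<open>c\<close> belongs.\<close>

definition decentralized :: "('w \<Rightarrow> real^'m) \<Rightarrow> bool" where
  "decentralized u \<longleftrightarrow> (\<exists>w. (\<forall>c. w c \<in> borel_measurable borel) \<and>
     (\<forall>c. \<forall>\<omega>\<in>space M. u \<omega> $ c = w c (block_row sx (su c) (X \<omega>))))"

lemma X_measurable [measurable]: "X \<in> borel_measurable M"
  using sq_X by (rule sq_integrable_measurable)

lemma decentralized_measurable: "decentralized u \<Longrightarrow> u \<in> borel_measurable M"
proof -
  assume "decentralized u"
  then obtain w where [measurable]: "\<And>c. w c \<in> borel_measurable borel"
    and u: "\<And>c \<omega>. \<omega> \<in> space M \<Longrightarrow> u \<omega> $ c = w c (block_row sx (su c) (X \<omega>))"
    unfolding decentralized_def by blast
  show ?thesis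
  proof (rule borel_measurable_vecI)
    fix c
    have "(\<lambda>\<omega>. w c (block_row sx (su c) (X \<omega>))) \<in> borel_measurable M" by measurable
    then show "(\<lambda>\<omega>. u \<omega> $ c) \<in> borel_measurable M" by (simp add: u cong: measurable_cong)
  qed
qed

lemma sq_dev: "sq_integrable M (dev i)"
  unfolding dev_def
  by (intro sq_integrable_linear[OF bounded_linear_block_row] sq_integrable_diff sq_X sq_integrable_const)

lemma X_eq_mean_plus_dev: "X \<omega> = mean + (\<Sum>i\<in>UNIV. dev i \<omega>)"
  by (simp add: dev_def sum_block_row)

lemma dev_eq: "dev i \<omega> = block_row sx i (X \<omega>) - block_row sx i mean"
  by (simp add: dev_def block_row_diff)

lemma integral_dev: "(\<integral>\<omega>. dev i \<omega> \<partial>M) = 0"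
proof -
  have iX: "integrable M X" by (rule sq_integrable_imp_integrable[OF sq_X])
  then have "(\<integral>\<omega>. dev i \<omega> \<partial>M) = block_row sx i (\<integral>\<omega>. X \<omega> - mean \<partial>M)"
    unfolding dev_def by (intro integral_bounded_linear[OF bounded_linear_block_row]) simp
  also have "(\<integral>\<omega>. X \<omega> - mean \<partial>M) = 0"
    using iX by (simp add: mean_def prob_space)
  finally show ?thesis
    by (simp add: linear_0[OF bounded_linear.linear[OF bounded_linear_block_row]])
qed

lemma integral_linear_dev:
  "bounded_linear L \<Longrightarrow> (\<integral>\<omega>. L (dev i \<omega>) \<partial>M) = 0"
  by (subst integral_bounded_linear)
    (auto simp: integral_dev sq_integrable_imp_integrable[OF sq_dev]
      linear_0[OF bounded_linear.linear])

lemma bounded_linear_dev_functional: "bounded_linear (\<lambda>S. y \<bullet> (Z *v ((S::real^'n^'n) *v x)))"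
  by (intro bounded_linear_inner_right_comp bounded_linear_compose[OF matrix_vector_mul_bounded_linear]
      bounded_linear_matrix_vector_mult_left)

text \<open>A centred row block has mean zero and is independent of every other row block, hence
  uncorrelated with every function of another row block.\<close>

lemma uncorrelated_row:
  fixes f :: "real^'n^'n \<Rightarrow> real" and L :: "real^'n^'n \<Rightarrow> real"
  assumes ij: "i \<noteq> j" and f: "f \<in> borel_measurable borel"
    and int: "integrable M (\<lambda>\<omega>. f (block_row sx i (X \<omega>)))" and L: "bounded_linear L"
  shows "(\<integral>\<omega>. f (block_row sx i (X \<omega>)) * L (dev j \<omega>) \<partial>M) = 0"
proof -
  let ?g = "\<lambda>S. L (S - block_row sx j mean)"
  have g: "?g \<in> borel_measurable borel"
    by (rule borel_measurable_bounded_linear[OF L]) simp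
  have "indep_var borel (f \<circ> (\<lambda>\<omega>. block_row sx i (X \<omega>))) borel (?g \<circ> (\<lambda>\<omega>. block_row sx j (X \<omega>)))"
    by (rule indep_var_compose[OF rows_indep[OF ij] f g])
  then have iv: "indep_var borel (\<lambda>\<omega>. f (block_row sx i (X \<omega>))) borel (\<lambda>\<omega>. L (dev j \<omega>))"
    by (simp add: comp_def dev_eq)
  have iL: "integrable M (\<lambda>\<omega>. L (dev j \<omega>))"
    by (intro integrable_bounded_linear[OF L] sq_integrable_imp_integrable sq_dev)
  show ?thesis
    unfolding indep_var_lebesgue_integral[OF iv int iL] integral_linear_dev[OF L] by simp
qed

context
  fixes P :: "real^'n^'n"
  assumes P: "psd P"
begin

lemma weight_pos: "sym_pos_def (weight P)"
  unfolding sym_pos_def_quad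
proof (intro conjI allI impI)
  show "transpose (weight P) = weight P"
    using R_pos psd_transpose[OF P]
    by (simp add: weight_def transpose_add matrix_transpose_mul sym_pos_def_quad matrix_mul_assoc)
  show "0 < quad (weight P) x" if "x \<noteq> 0" for x
    using R_pos psd_quad_nonneg[OF P, of "B *v x"] that
    by (simp add: weight_def quad_add quad_congruence sym_pos_def_quad add_pos_nonneg)
qed

lemma weight_mean_gain: "weight P *v (mean_gain P *v z) = transpose B *v (P *v z)"
  by (simp add: mean_gain_def matrix_vector_mul_assoc matrix_mul_assoc matrix_inv_works(1)[OF weight_pos])

lemma local_weight_eq:
  "local_weight i P = mat_on {c. su c = i} ** weight P ** mat_on {c. su c = i}"
proof -
  have "local_weight i P *v z = mat_on {c. su c = i} *v (weight P *v (mat_on {c. su c = i} *v z))" for z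
    by (simp add: local_weight_def weight_def block_col_eq diag_block_eq matrix_transpose_mul
        transpose_mat_on matrix_vector_mult_add_rdistrib matrix_vector_right_distrib
        matrix_vector_mul_assoc[symmetric])
  then show ?thesis by (simp add: matrix_eq matrix_vector_mul_assoc[symmetric])
qed

lemma local_inverse:
  shows "local_weight i P ** inv_on {c. su c = i} (local_weight i P) = mat_on {c. su c = i}"
    and "transpose (inv_on {c. su c = i} (local_weight i P)) = inv_on {c. su c = i} (local_weight i P)"
    and "su c \<noteq> i \<Longrightarrow> inv_on {c. su c = i} (local_weight i P) $ c $ d = 0"
proof -
  let ?I = "{c. su c = i}"
  have t: "transpose (local_weight i P) = local_weight i P"
    using weight_pos
    by (simp add: local_weight_eq matrix_transpose_mul transpose_mat_on sym_pos_def_quad matrix_mul_assoc)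
  have s: "\<not> (a \<in> ?I \<and> b \<in> ?I) \<Longrightarrow> local_weight i P $ a $ b = 0" for a b
    by (auto simp: local_weight_eq mat_on_entry_mult)
  have p: "0 < quad (local_weight i P) x" if "x \<noteq> 0" and sup: "\<And>a. a \<notin> ?I \<Longrightarrow> x $ a = 0" for x
  proof -
    have "mat_on ?I *v x = x" using sup by (auto simp: vec_eq_iff mat_on_vec)
    then have "quad (local_weight i P) x = quad (weight P) x"
      using quad_congruence[of "mat_on ?I" "weight P" x] by (simp add: local_weight_eq transpose_mat_on)
    then show ?thesis using weight_pos that by (simp add: sym_pos_def_quad)
  qed
  show "local_weight i P ** inv_on ?I (local_weight i P) = mat_on ?I"
    by (rule inv_on_works(1)[OF t s p]) auto
  show "transpose (inv_on ?I (local_weight i P)) = inv_on ?I (local_weight i P)"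
    by (rule inv_on_works(2)[OF t s p]) auto
  show "su c \<noteq> i \<Longrightarrow> inv_on ?I (local_weight i P) $ c $ d = 0"
    by (rule inv_on_works(3)[OF t s p]) auto
qed

lemma local_gain_component: "su c \<noteq> i \<Longrightarrow> (local_gain i P *v z) $ c = 0"
  by (simp add: local_gain_def matrix_vector_mul_assoc[symmetric] matrix_vector_mul_component
      inner_vec_def local_inverse(3))

lemma mat_on_local_gain: "mat_on {c. su c = i} *v (local_gain i P *v z) = local_gain i P *v z"
  by (auto simp: vec_eq_iff mat_on_vec local_gain_component)

text \<open>On the coordinates of subsystem \<open>i\<close> the local gain solves the stationarity condition of the full
  problem, although it is defined from block \<open>i\<close> of the weight only.\<close>

lemma weight_local_gain:
  assumes "su c = i"
  shows "(weight P *v (local_gain i P *v z)) $ c = (transpose B *v (P *v z)) $ c"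
proof -
  let ?E = "mat_on {c. su c = i}"
  have "?E *v (weight P *v (local_gain i P *v z)) = local_weight i P *v (local_gain i P *v z)"
    by (simp add: local_weight_eq matrix_vector_mul_assoc[symmetric] mat_on_local_gain)
  also have "\<dots> = ?E *v (transpose (block_col su i B) *v (P *v z))"
    by (simp add: local_gain_def matrix_vector_mul_assoc matrix_mul_assoc local_inverse(1))
  also have "\<dots> = ?E *v (transpose B *v (P *v z))"
    by (simp add: block_col_eq matrix_transpose_mul transpose_mat_on vec_eq_iff mat_on_vec
        matrix_vector_mul_assoc[symmetric])
  finally have "(?E *v (weight P *v (local_gain i P *v z))) $ c = (?E *v (transpose B *v (P *v z))) $ c"
    by simp
  then show ?thesis using assms by (simp add: mat_on_vec)
qed

lemma sq_opt_input: "sq_integrable M (opt_input P x)"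
  unfolding opt_input_def
  by (intro sq_integrable_diff sq_integrable_const sq_integrable_sum sq_integrable_vm sq_integrable_mv sq_dev)

lemma local_gain_sum_component: "(\<Sum>i\<in>UNIV. local_gain i P *v z i) $ c = (local_gain (su c) P *v z (su c)) $ c"
proof -
  have "(\<Sum>i\<in>UNIV. local_gain i P *v z i) $ c
      = (\<Sum>i\<in>UNIV. if i = su c then (local_gain (su c) P *v z (su c)) $ c else 0)"
    unfolding sum_component by (intro sum.cong) (auto simp: local_gain_component)
  then show ?thesis by simp
qed

lemma decentralized_opt_input: "decentralized (opt_input P x)"
  unfolding decentralized_def
proof (intro exI conjI allI ballI)
  let ?w = "\<lambda>c S. - (mean_gain P *v (mean *v x)) $ c
      - (local_gain (su c) P *v ((S - block_row sx (su c) mean) *v x)) $ c"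
  show "?w c \<in> borel_measurable borel" for c by measurable
  show "opt_input P x \<omega> $ c = ?w c (block_row sx (su c) (X \<omega>))" for c \<omega>
    by (simp only: opt_input_def vector_minus_component vector_uminus_component local_gain_sum_component dev_eq)
qed

lemma integrable_riccati_on:
  "integrable M (\<lambda>\<omega>. riccati_on I (dev i \<omega>) Y B' R')"
  unfolding riccati_on_def by (rule sq_integrable_congruence[OF sq_dev])

text \<open>Half the gradient of \<open>u \<mapsto> q\<^sub>R u + q\<^sub>P (X x + B u)\<close> at the optimal input.\<close>

definition gradient :: "real^'n \<Rightarrow> 'w \<Rightarrow> real^'m" where
  "gradient x \<omega> = R *v opt_input P x \<omega> + transpose B *v (P *v (X \<omega> *v x + B *v opt_input P x \<omega>))"

text \<open>The coefficient of the \<open>j\<close>-th centred row block in the gradient; its rows that belong to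
  subsystem \<open>j\<close> vanish (\<open>grad_mat_component\<close>).\<close>

definition grad_mat :: "'s \<Rightarrow> real^'n^'m" where
  "grad_mat j = transpose B ** P - weight P ** local_gain j P"

lemma gradient_eq: "gradient x \<omega> = (\<Sum>j\<in>UNIV. grad_mat j *v (dev j \<omega> *v x))"
proof -
  have "gradient x \<omega> = transpose B *v (P *v (X \<omega> *v x)) + weight P *v opt_input P x \<omega>"
    by (simp add: gradient_def weight_def algebra_simps matrix_vector_mul_assoc matrix_mul_assoc)
  also have "weight P *v opt_input P x \<omega> = - (transpose B *v (P *v (mean *v x)))
      - (\<Sum>j\<in>UNIV. weight P *v (local_gain j P *v (dev j \<omega> *v x)))"
    by (simp add: opt_input_def matrix_vector_mult_diff_distrib weight_mean_gain
       matrix_vector_mult_sum linear_neg[OF matrix_vector_mul_linear])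
  also have "transpose B *v (P *v (X \<omega> *v x)) = transpose B *v (P *v (mean *v x))
      + (\<Sum>j\<in>UNIV. transpose B *v (P *v (dev j \<omega> *v x)))"
    by (subst X_eq_mean_plus_dev)
      (simp add: matrix_vector_mult_add_rdistrib matrix_vector_right_distrib matrix_sum_vector_mult
        matrix_vector_mult_sum)
  finally show ?thesis
    by (simp add: grad_mat_def matrix_vector_mult_diff_rdistrib sum_subtractf
        matrix_vector_mul_assoc[symmetric])
qed

lemma grad_mat_component: "su c = j \<Longrightarrow> (grad_mat j *v z) $ c = 0"
  by (simp add: grad_mat_def matrix_vector_mult_diff_rdistrib matrix_vector_mul_assoc[symmetric]
     weight_local_gain)

lemma sq_gradient: "sq_integrable M (gradient x)"
  unfolding gradient_def[abs_def]
  by (intro sq_integrable_add sq_integrable_vm sq_integrable_mv sq_opt_input sq_X)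

text \<open>First order optimality within the class of decentralized inputs.\<close>

lemma gradient_orthogonal:
  assumes v: "decentralized v" and sq: "sq_integrable M v"
  shows "(\<integral>\<omega>. v \<omega> \<bullet> gradient x \<omega> \<partial>M) = 0"
proof -
  obtain w where w: "\<And>c. w c \<in> borel_measurable borel"
    and vw: "\<And>c \<omega>. \<omega> \<in> space M \<Longrightarrow> v \<omega> $ c = w c (block_row sx (su c) (X \<omega>))"
    using v unfolding decentralized_def by blast
  have sqc: "sq_integrable M (\<lambda>\<omega>. v \<omega> $ c)" for c
    by (rule sq_integrable_linear[OF bounded_linear_vec_nth sq])
  have sqd: "sq_integrable M (\<lambda>\<omega>. (grad_mat j *v (dev j \<omega> *v x)) $ c)" for j c
    by (intro sq_integrable_linear[OF bounded_linear_vec_nth] sq_integrable_vm sq_integrable_mv sq_dev)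
  have zero: "(\<integral>\<omega>. v \<omega> $ c * (grad_mat j *v (dev j \<omega> *v x)) $ c \<partial>M) = 0" for j c
  proof (cases "su c = j")
    case True
    then show ?thesis by (simp add: grad_mat_component)
  next
    case False
    have L: "bounded_linear (\<lambda>S. (grad_mat j *v ((S::real^'n^'n) *v x)) $ c)"
      by (intro bounded_linear_compose[OF bounded_linear_vec_nth]
          bounded_linear_compose[OF matrix_vector_mul_bounded_linear] bounded_linear_matrix_vector_mult_left)
    \<comment> \<open>The two factors depend on different row blocks, and the second has mean zero.\<close>
    have "integrable M (\<lambda>\<omega>. v \<omega> $ c)" by (rule sq_integrable_imp_integrable[OF sqc])
    then have "integrable M (\<lambda>\<omega>. w c (block_row sx (su c) (X \<omega>)))"
      by (simp add: vw cong: Bochner_Integration.integrable_cong)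
    from uncorrelated_row[OF False w this L] show ?thesis
      by (simp add: vw cong: Bochner_Integration.integral_cong)
  qed
  have "(\<integral>\<omega>. v \<omega> \<bullet> gradient x \<omega> \<partial>M)
      = (\<integral>\<omega>. (\<Sum>c\<in>UNIV. \<Sum>j\<in>UNIV. v \<omega> $ c * (grad_mat j *v (dev j \<omega> *v x)) $ c) \<partial>M)"
    by (simp add: gradient_eq inner_vec_def sum_distrib_left)
  also have "\<dots> = (\<Sum>c\<in>UNIV. \<Sum>j\<in>UNIV. \<integral>\<omega>. v \<omega> $ c * (grad_mat j *v (dev j \<omega> *v x)) $ c \<partial>M)"
    using sq_integrable_inner[OF sqc sqd] by (simp add: integral_sum)
  finally show ?thesis by (simp add: zero)
qed

lemma transpose_riccati_map: "transpose (riccati_map P) = riccati_map P"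
proof -
  have "transpose (riccati mean P B R) = riccati mean P B R"
    unfolding riccati_on_UNIV[symmetric]
    by (rule transpose_riccati_on[OF psd_transpose[OF P]])
      (use matrix_inv_works(2)[OF weight_pos] in \<open>simp add: inv_on_UNIV weight_def\<close>)
  moreover have "transpose (\<integral>\<omega>. riccati_on {c. su c = i} (dev i \<omega>) P (block_col su i B) (diag_block su i R) \<partial>M)
      = (\<integral>\<omega>. riccati_on {c. su c = i} (dev i \<omega>) P (block_col su i B) (diag_block su i R) \<partial>M)" for i
    by (simp add: transpose_integral integrable_riccati_on
        transpose_riccati_on[OF psd_transpose[OF P] local_inverse(2)[unfolded local_weight_def]])
  ultimately show ?thesis
    by (simp add: riccati_map_def transpose_add transpose_sum)
qed

lemma dev_uncorrelated:
  assumes "i \<noteq> j"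
  shows "(\<integral>\<omega>. (dev i \<omega> *v x) \<bullet> (Z *v (dev j \<omega> *v y)) \<partial>M) = 0"
proof -
  have "(\<integral>\<omega>. (dev i \<omega> *v x) $ a * (Z *v (dev j \<omega> *v y)) $ a \<partial>M) = 0" for a
  proof -
    let ?f = "\<lambda>S. ((S - block_row sx i mean) *v x) $ a"
    have L: "bounded_linear (\<lambda>S. (Z *v ((S::real^'n^'n) *v y)) $ a)"
      by (intro bounded_linear_compose[OF bounded_linear_vec_nth]
          bounded_linear_compose[OF matrix_vector_mul_bounded_linear] bounded_linear_matrix_vector_mult_left)
    have f: "?f \<in> borel_measurable borel" by measurable
    have eq: "(dev i \<omega> *v x) $ a = ?f (block_row sx i (X \<omega>))" for \<omega> by (simp add: dev_eq)
    have "integrable M (\<lambda>\<omega>. (dev i \<omega> *v x) $ a)"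
      by (intro sq_integrable_imp_integrable sq_integrable_linear[OF bounded_linear_vec_nth]
          sq_integrable_mv sq_dev)
    from uncorrelated_row[OF assms f this[unfolded eq] L] show ?thesis
      by (simp only: eq[symmetric])
  qed
  moreover have "integrable M (\<lambda>\<omega>. (dev i \<omega> *v x) $ a * (Z *v (dev j \<omega> *v y)) $ a)" for a
    using sq_integrable_inner[OF sq_integrable_linear[OF bounded_linear_vec_nth[of a]]
       sq_integrable_linear[OF bounded_linear_vec_nth[of a]], OF sq_integrable_mv[OF sq_dev]
       sq_integrable_vm[OF sq_integrable_mv[OF sq_dev]]] by simp
  ultimately show ?thesis
    by (simp add: inner_vec_def integral_sum)
qed

text \<open>By orthogonality of the gradient to the optimal input, the right-hand side is the cost of the
  optimal input (see \<open>stage_cost_sq\<close>).\<close>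

lemma quad_riccati_map:
  "quad (riccati_map P) x = (\<integral>\<omega>. (X \<omega> *v x) \<bullet> (P *v (X \<omega> *v x + B *v opt_input P x \<omega>)) \<partial>M)"
proof -
  let ?d = "\<lambda>i \<omega>. dev i \<omega> *v x" and ?m = "mean *v x"
  let ?H = "\<lambda>j. mat 1 - B ** local_gain j P"
  define m' where "m' = ?m - B *v (mean_gain P *v ?m)"
  have state: "X \<omega> *v x = ?m + (\<Sum>i\<in>UNIV. ?d i \<omega>)" for \<omega>
    by (subst X_eq_mean_plus_dev) (simp add: matrix_vector_mult_add_rdistrib matrix_sum_vector_mult)
  have next_state: "X \<omega> *v x + B *v opt_input P x \<omega> = m' + (\<Sum>j\<in>UNIV. ?H j *v ?d j \<omega>)" for \<omega>
    by (simp add: state m'_def opt_input_def matrix_vector_mult_diff_distrib matrix_vector_mult_diff_rdistrib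
       matrix_vector_mult_sum sum_subtractf linear_neg[OF matrix_vector_mul_linear]
       matrix_vector_mul_assoc[symmetric])
  have sqd: "sq_integrable M (?d i)" for i by (intro sq_integrable_mv sq_dev)
  have i1: "integrable M (\<lambda>\<omega>. ?m \<bullet> (P *v (?H j *v ?d j \<omega>)))" for j
    by (intro sq_integrable_inner sq_integrable_const sq_integrable_vm sqd)
  have i2: "integrable M (\<lambda>\<omega>. ?d i \<omega> \<bullet> (P *v m'))" for i
    by (intro sq_integrable_inner sq_integrable_const sqd)
  have i3: "integrable M (\<lambda>\<omega>. ?d i \<omega> \<bullet> (P *v (?H j *v ?d j \<omega>)))" for i j
    by (intro sq_integrable_inner sq_integrable_vm sqd)
  have z1: "(\<integral>\<omega>. ?m \<bullet> (P *v (?H j *v ?d j \<omega>)) \<partial>M) = 0" for j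
    using integral_linear_dev[OF bounded_linear_dev_functional[of ?m "P ** ?H j" x], of j]
    by (simp only: matrix_vector_mul_assoc matrix_mul_assoc)
  have z2: "(\<integral>\<omega>. ?d i \<omega> \<bullet> (P *v m') \<partial>M) = 0" for i
    using integral_linear_dev[OF bounded_linear_dev_functional[of "P *v m'" "mat 1" x], of i]
    by (simp add: inner_commute)
  have z3: "(\<Sum>i\<in>UNIV. \<integral>\<omega>. ?d i \<omega> \<bullet> (P *v (?H j *v ?d j \<omega>)) \<partial>M)
      = (\<integral>\<omega>. ?d j \<omega> \<bullet> (P *v (?H j *v ?d j \<omega>)) \<partial>M)" for j
  proof -
    have "(\<integral>\<omega>. ?d i \<omega> \<bullet> (P *v (?H j *v ?d j \<omega>)) \<partial>M) = 0" if "i \<noteq> j" for i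
      using dev_uncorrelated[OF that, of x "P ** ?H j" x]
      by (simp only: matrix_vector_mul_assoc matrix_mul_assoc)
    then show ?thesis by (subst sum.remove[of UNIV j]) simp_all
  qed
  have "(\<integral>\<omega>. (X \<omega> *v x) \<bullet> (P *v (X \<omega> *v x + B *v opt_input P x \<omega>)) \<partial>M)
    = (\<integral>\<omega>. ?m \<bullet> (P *v m') + (\<Sum>j\<in>UNIV. ?m \<bullet> (P *v (?H j *v ?d j \<omega>)))
        + (\<Sum>i\<in>UNIV. ?d i \<omega> \<bullet> (P *v m'))
        + (\<Sum>j\<in>UNIV. \<Sum>i\<in>UNIV. ?d i \<omega> \<bullet> (P *v (?H j *v ?d j \<omega>))) \<partial>M)"
    unfolding next_state unfolding state
    by (simp only: matrix_vector_right_distrib matrix_vector_mult_sum inner_add_left inner_add_right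
        inner_sum_left inner_sum_right add_ac sum.distrib)
  also have "\<dots> = ?m \<bullet> (P *v m') + (\<Sum>i\<in>UNIV. \<integral>\<omega>. ?d i \<omega> \<bullet> (P *v (?H i *v ?d i \<omega>)) \<partial>M)"
    using i1 i2 i3 by (simp add: integral_sum z1 z2 z3 prob_space)
  also have "?m \<bullet> (P *v m') = quad (riccati mean P B R) x"
    by (simp add: riccati_on_UNIV[symmetric] quad_riccati_on m'_def mean_gain_def weight_def inv_on_UNIV)
  finally have total: "(\<integral>\<omega>. (X \<omega> *v x) \<bullet> (P *v (X \<omega> *v x + B *v opt_input P x \<omega>)) \<partial>M)
    = quad (riccati mean P B R) x + (\<Sum>i\<in>UNIV. \<integral>\<omega>. ?d i \<omega> \<bullet> (P *v (?H i *v ?d i \<omega>)) \<partial>M)" .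
  have local_value: "(\<integral>\<omega>. ?d i \<omega> \<bullet> (P *v (?H i *v ?d i \<omega>)) \<partial>M)
     = quad (\<integral>\<omega>. riccati_on {c. su c = i} (dev i \<omega>) P (block_col su i B) (diag_block su i R) \<partial>M) x" for i
  proof -
    have "block_col su i B *v (local_gain i P *v z) = B *v (local_gain i P *v z)" for z
      by (simp add: block_col_eq matrix_vector_mul_assoc[symmetric] mat_on_local_gain)
    then show ?thesis
      by (simp add: quad_integral integrable_riccati_on quad_riccati_on local_weight_def[symmetric]
          local_gain_def[symmetric] matrix_vector_mult_diff_rdistrib matrix_vector_mul_assoc[of B, symmetric])
  qed
  show ?thesis by (simp only: total riccati_map_def quad_add quad_sum local_value)
qed

text \<open>Completion of the square around the optimal input.\<close>

lemma stage_cost_sq: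
  assumes u: "decentralized u" and sq: "sq_integrable M u"
  shows "(\<integral>\<omega>. quad R (u \<omega>) + quad P (X \<omega> *v x + B *v u \<omega>) \<partial>M)
     = quad (riccati_map P) x + (\<integral>\<omega>. quad (weight P) (u \<omega> - opt_input P x \<omega>) \<partial>M)"
proof -
  let ?o = "opt_input P x"
  let ?v = "\<lambda>\<omega>. u \<omega> - ?o \<omega>"
  have pw: "quad R (u \<omega>) + quad P (X \<omega> *v x + B *v u \<omega>)
    = (X \<omega> *v x) \<bullet> (P *v (X \<omega> *v x + B *v ?o \<omega>)) + ?o \<omega> \<bullet> gradient x \<omega>
      + 2 * (?v \<omega> \<bullet> gradient x \<omega>) + quad (weight P) (?v \<omega>)" for \<omega>
  proof -
    define y where "y = X \<omega> *v x + B *v ?o \<omega>"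
    have tR: "transpose R = R" and tP: "transpose P = P"
      using R_pos P by (auto simp: sym_pos_def_def psd_def)
    have "quad R (u \<omega>) = quad R (?v \<omega> + ?o \<omega>)" by simp
    also have "\<dots> = quad R (?v \<omega>) + 2 * (?v \<omega> \<bullet> (R *v ?o \<omega>)) + quad R (?o \<omega>)"
      by (rule quad_plus_vec[OF tR])
    finally have 1: "quad R (u \<omega>) = quad R (?v \<omega>) + 2 * (?v \<omega> \<bullet> (R *v ?o \<omega>)) + quad R (?o \<omega>)" .
    have "X \<omega> *v x + B *v u \<omega> = B *v ?v \<omega> + y" by (simp add: y_def algebra_simps)
    then have "quad P (X \<omega> *v x + B *v u \<omega>) = quad P (B *v ?v \<omega>) + 2 * ((B *v ?v \<omega>) \<bullet> (P *v y)) + quad P y"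
      by (simp add: quad_plus_vec[OF tP])
    moreover have "quad P y = (X \<omega> *v x) \<bullet> (P *v y) + (B *v ?o \<omega>) \<bullet> (P *v y)"
      by (simp add: quad_def y_def inner_add_left)
    moreover have "gradient x \<omega> = R *v ?o \<omega> + transpose B *v (P *v y)"
      by (simp add: gradient_def y_def)
    ultimately show ?thesis
      unfolding 1 y_def[symmetric]
      by (simp add: weight_def quad_add quad_congruence inner_add_right inner_transpose_right)
        (simp add: quad_def)
  qed
  have sqv: "sq_integrable M ?v" by (intro sq_integrable_diff sq sq_opt_input)
  have dv: "decentralized ?v"
  proof -
    from u decentralized_opt_input[of x] obtain w w' where
      w: "\<And>c. w c \<in> borel_measurable borel" "\<And>c. w' c \<in> borel_measurable borel"
      and uw: "\<And>c \<omega>. \<omega> \<in> space M \<Longrightarrow> u \<omega> $ c = w c (block_row sx (su c) (X \<omega>))"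
        "\<And>c \<omega>. \<omega> \<in> space M \<Longrightarrow> ?o \<omega> $ c = w' c (block_row sx (su c) (X \<omega>))"
      unfolding decentralized_def by blast
    have "(\<lambda>S. w c S - w' c S) \<in> borel_measurable borel" for c
      using w by (intro borel_measurable_diff)
    then show ?thesis
      unfolding decentralized_def using uw by (intro exI[of _ "\<lambda>c S. w c S - w' c S"]) auto
  qed
  have "integrable M (\<lambda>\<omega>. (X \<omega> *v x) \<bullet> (P *v (X \<omega> *v x + B *v ?o \<omega>)))"
    by (intro sq_integrable_inner sq_integrable_add sq_integrable_vm sq_integrable_mv sq_X sq_opt_input)
  moreover have "integrable M (\<lambda>\<omega>. ?o \<omega> \<bullet> gradient x \<omega>)" "integrable M (\<lambda>\<omega>. ?v \<omega> \<bullet> gradient x \<omega>)"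
    by (intro sq_integrable_inner sq_opt_input sq_gradient sqv)+
  moreover have "integrable M (\<lambda>\<omega>. quad (weight P) (?v \<omega>))"
    by (rule sq_integrable_quad[OF sqv])
  ultimately show ?thesis
    unfolding pw
    by (simp add: quad_riccati_map gradient_orthogonal[OF dv sqv]
        gradient_orthogonal[OF decentralized_opt_input sq_opt_input])
qed

lemma riccati_map_nonneg: "0 \<le> quad (riccati_map P) x"
proof -
  have "0 \<le> (\<integral>\<omega>. quad R (opt_input P x \<omega>) + quad P (X \<omega> *v x + B *v opt_input P x \<omega>) \<partial>M)"
    using P R_pos by (intro Bochner_Integration.integral_nonneg add_nonneg_nonneg) (auto intro!: psd_quad_nonneg sym_pos_def_imp_psd)
  then show ?thesis
    by (subst (asm) stage_cost_sq[OF decentralized_opt_input sq_opt_input]) simp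
qed

text \<open>The same identity in \<open>[0, \<infinity>]\<close>. If \<open>u\<close> is not square integrable, both sides are infinite, since
  \<open>R\<close> and \<open>weight P\<close> are positive definite and the optimal input is square integrable.\<close>

lemma stage_cost:
  assumes u: "decentralized u"
  shows "(\<integral>\<^sup>+\<omega>. ennreal (quad R (u \<omega>) + quad P (X \<omega> *v x + B *v u \<omega>)) \<partial>M)
     = ennreal (quad (riccati_map P) x) + (\<integral>\<^sup>+\<omega>. ennreal (quad (weight P) (u \<omega> - opt_input P x \<omega>)) \<partial>M)"
proof (cases "sq_integrable M u")
  case True
  have nnR: "0 \<le> quad R z" and nnP: "0 \<le> quad P z'" and nnW: "0 \<le> quad (weight P) z" for z z'
    using P R_pos weight_pos by (auto intro!: psd_quad_nonneg sym_pos_def_imp_psd)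
  have "(\<integral>\<^sup>+\<omega>. ennreal (quad R (u \<omega>) + quad P (X \<omega> *v x + B *v u \<omega>)) \<partial>M)
    = ennreal (\<integral>\<omega>. quad R (u \<omega>) + quad P (X \<omega> *v x + B *v u \<omega>) \<partial>M)"
    by (intro nn_integral_eq_integral Bochner_Integration.integrable_add sq_integrable_quad
        sq_integrable_add sq_integrable_vm sq_integrable_mv sq_X True AE_I2 add_nonneg_nonneg nnR nnP)
  also have "\<dots> = ennreal (quad (riccati_map P) x) + ennreal (\<integral>\<omega>. quad (weight P) (u \<omega> - opt_input P x \<omega>) \<partial>M)"
    unfolding stage_cost_sq[OF u True] by (intro ennreal_plus riccati_map_nonneg Bochner_Integration.integral_nonneg nnW)
  also have "ennreal (\<integral>\<omega>. quad (weight P) (u \<omega> - opt_input P x \<omega>) \<partial>M)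
      = (\<integral>\<^sup>+\<omega>. ennreal (quad (weight P) (u \<omega> - opt_input P x \<omega>)) \<partial>M)"
    by (intro nn_integral_eq_integral[symmetric] sq_integrable_quad sq_integrable_diff
        True sq_opt_input AE_I2 nnW)
  finally show ?thesis .
next
  case False
  have um: "u \<in> borel_measurable M" by (rule decentralized_measurable[OF u])
  have om: "opt_input P x \<in> borel_measurable M" by (rule sq_integrable_measurable[OF sq_opt_input])
  have "\<not> (\<integral>\<^sup>+\<omega>. ennreal (quad R (u \<omega>)) \<partial>M) < \<infinity>"
    using sq_integrable_of_quad[OF R_pos um] False by blast
  then have "(\<integral>\<^sup>+\<omega>. ennreal (quad R (u \<omega>)) \<partial>M) = \<infinity>"
    by (simp add: less_top[symmetric])
  moreover have "(\<integral>\<^sup>+\<omega>. ennreal (quad R (u \<omega>)) \<partial>M)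
      \<le> (\<integral>\<^sup>+\<omega>. ennreal (quad R (u \<omega>) + quad P (X \<omega> *v x + B *v u \<omega>)) \<partial>M)"
    using psd_quad_nonneg[OF P] by (intro nn_integral_mono ennreal_leI) simp
  ultimately have l: "(\<integral>\<^sup>+\<omega>. ennreal (quad R (u \<omega>) + quad P (X \<omega> *v x + B *v u \<omega>)) \<partial>M) = \<infinity>"
    by (simp add: top_unique)
  have "\<not> (\<integral>\<^sup>+\<omega>. ennreal (quad (weight P) (u \<omega> - opt_input P x \<omega>)) \<partial>M) < \<infinity>"
  proof
    assume "(\<integral>\<^sup>+\<omega>. ennreal (quad (weight P) (u \<omega> - opt_input P x \<omega>)) \<partial>M) < \<infinity>"
    then have "sq_integrable M (\<lambda>\<omega>. u \<omega> - opt_input P x \<omega>)"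
      by (intro sq_integrable_of_quad[OF weight_pos] borel_measurable_diff um om)
    from sq_integrable_add[OF this sq_opt_input[of x]] False show False by simp
  qed
  then have "(\<integral>\<^sup>+\<omega>. ennreal (quad (weight P) (u \<omega> - opt_input P x \<omega>)) \<partial>M) = \<infinity>"
    by (simp add: less_top[symmetric])
  with l show ?thesis by simp
qed

lemma riccati_map_le:
  assumes "decentralized u" "sq_integrable M u"
  shows "quad (riccati_map P) x \<le> (\<integral>\<omega>. quad R (u \<omega>) + quad P (X \<omega> *v x + B *v u \<omega>) \<partial>M)"
  unfolding stage_cost_sq[OF assms]
  using weight_pos by (simp add: Bochner_Integration.integral_nonneg psd_quad_nonneg sym_pos_def_imp_psd)

lemma riccati_map_attained:
  "quad (riccati_map P) x = (\<integral>\<omega>. quad R (opt_input P x \<omega>) + quad P (X \<omega> *v x + B *v opt_input P x \<omega>) \<partial>M)"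
  by (simp add: stage_cost_sq[OF decentralized_opt_input sq_opt_input])

lemma psd_riccati_map: "psd (riccati_map P)"
  by (simp add: psd_def transpose_riccati_map riccati_map_nonneg)

end

text \<open>The optimal input for \<open>P'\<close> is admissible for \<open>P\<close>.\<close>

lemma riccati_map_mono:
  assumes P: "psd P" and P': "psd P'" and le: "\<And>x. quad P x \<le> quad P' x"
  shows "quad (riccati_map P) x \<le> quad (riccati_map P') x"
proof -
  let ?u = "opt_input P' x"
  have sq: "sq_integrable M (\<lambda>\<omega>. X \<omega> *v x + B *v ?u \<omega>)"
    by (intro sq_integrable_add sq_integrable_mv sq_integrable_vm sq_X sq_opt_input P')
  have "quad (riccati_map P) x \<le> (\<integral>\<omega>. quad R (?u \<omega>) + quad P (X \<omega> *v x + B *v ?u \<omega>) \<partial>M)"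
    by (intro riccati_map_le P decentralized_opt_input P' sq_opt_input)
  also have "\<dots> \<le> (\<integral>\<omega>. quad R (?u \<omega>) + quad P' (X \<omega> *v x + B *v ?u \<omega>) \<partial>M)"
    by (intro integral_mono Bochner_Integration.integrable_add sq_integrable_quad sq sq_opt_input P'
        add_mono order_refl le)
  also have "\<dots> = quad (riccati_map P') x" by (rule riccati_map_attained[OF P', symmetric])
  finally show ?thesis .
qed

text \<open>Scaling \<open>P\<close> by \<open>c \<le> 1\<close> leaves the term \<open>q\<^sub>R u\<close> of the minimized cost unscaled. Together with
  monotonicity this replaces a continuity argument for the inverses in the Riccati operator.\<close>

lemma riccati_map_scale:
  assumes P: "psd P" and c: "0 \<le> c" "c \<le> 1"
  shows "c * quad (riccati_map P) x \<le> quad (riccati_map (c *\<^sub>R P)) x"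
proof -
  have cP: "psd (c *\<^sub>R P)" by (intro psd_scaleR P c)
  let ?u = "opt_input (c *\<^sub>R P) x"
  have sq: "sq_integrable M (\<lambda>\<omega>. X \<omega> *v x + B *v ?u \<omega>)" "sq_integrable M ?u"
    by (intro sq_integrable_add sq_integrable_mv sq_integrable_vm sq_X sq_opt_input cP)+
  have "c * quad (riccati_map P) x \<le> c * (\<integral>\<omega>. quad R (?u \<omega>) + quad P (X \<omega> *v x + B *v ?u \<omega>) \<partial>M)"
    by (intro mult_left_mono riccati_map_le P decentralized_opt_input cP sq c)
  also have "\<dots> = (\<integral>\<omega>. c * quad R (?u \<omega>) + quad (c *\<^sub>R P) (X \<omega> *v x + B *v ?u \<omega>) \<partial>M)"
    by (simp add: quad_scaleR distrib_left flip: integral_mult_right_zero)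
  also have "\<dots> \<le> (\<integral>\<omega>. quad R (?u \<omega>) + quad (c *\<^sub>R P) (X \<omega> *v x + B *v ?u \<omega>) \<partial>M)"
  proof (intro integral_mono Bochner_Integration.integrable_add integrable_mult_right sq_integrable_quad sq add_mono order_refl)
    fix \<omega>
    have "0 \<le> quad R (?u \<omega>)" using R_pos by (intro psd_quad_nonneg sym_pos_def_imp_psd)
    then show "c * quad R (?u \<omega>) \<le> quad R (?u \<omega>)" using c by (intro mult_left_le_one_le)
  qed
  also have "\<dots> = quad (riccati_map (c *\<^sub>R P)) x" by (rule riccati_map_attained[OF cP, symmetric])
  finally show ?thesis .
qed

end

section \<open>The closed loop and conditioning on the past\<close>

lemma sq_integrable_iff_entries:
  fixes F :: "'w \<Rightarrow> real^'n^'m"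
  assumes "F \<in> borel_measurable M" "\<And>a b. integrable M (\<lambda>\<omega>. (F \<omega> $ a $ b)\<^sup>2)"
  shows "sq_integrable M F"
  using assms by (simp add: sq_integrable_def inner_vec_def power2_eq_square)

text \<open>The state at time \<open>k\<close> depends on the system matrices at times before \<open>k\<close> only.\<close>

lemma state_cong:
  "(\<And>j. j < k \<Longrightarrow> S j = S' j) \<Longrightarrow> state sx su B \<psi> x0 S k = state sx su B \<psi> x0 S' k"
proof (induction k rule: less_induct)
  case (less k)
  show ?case
  proof (cases k)
    case (Suc l)
    have "state sx su B \<psi> x0 S j = state sx su B \<psi> x0 S' j" if "j \<le> l" for j
      using less that Suc by simp
    then have "(\<lambda>j\<in>{..l}. state sx su B \<psi> x0 S j) = (\<lambda>j\<in>{..l}. state sx su B \<psi> x0 S' j)"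
      "state sx su B \<psi> x0 S l = state sx su B \<psi> x0 S' l"
      by auto
    moreover have "S l = S' l" using less.prems Suc by simp
    ultimately show ?thesis unfolding Suc state.simps by simp
  qed simp
qed

lemma measurable_joint_input:
  fixes S :: "'w \<Rightarrow> real^'n::finite^'n" and \<psi> :: "('s, 'n, 'm::finite) law"
  assumes \<psi>: "limited_info \<psi>" and S: "S \<in> borel_measurable N"
    and H: "H \<in> N \<rightarrow>\<^sub>M (\<Pi>\<^sub>M j\<in>{..k}. borel)"
  shows "(\<lambda>\<omega>. joint_input sx su \<psi> k (S \<omega>) (H \<omega>)) \<in> borel_measurable N"
proof (rule borel_measurable_vecI)
  fix c
  have "(\<lambda>(S, h). \<psi> (su c) k S h) \<in> borel \<Otimes>\<^sub>M (\<Pi>\<^sub>M j\<in>{..k}. borel) \<rightarrow>\<^sub>M borel"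
    using \<psi> by (simp add: limited_info_def)
  moreover have "(\<lambda>\<omega>. (block_row sx (su c) (S \<omega>), H \<omega>)) \<in> N \<rightarrow>\<^sub>M borel \<Otimes>\<^sub>M (\<Pi>\<^sub>M j\<in>{..k}. borel)"
    using S H by (intro measurable_Pair borel_measurable_block_row)
  ultimately have "(\<lambda>\<omega>. \<psi> (su c) k (block_row sx (su c) (S \<omega>)) (H \<omega>)) \<in> borel_measurable N"
    using measurable_compose by fastforce
  then show "(\<lambda>\<omega>. joint_input sx su \<psi> k (S \<omega>) (H \<omega>) $ c) \<in> borel_measurable N"
    by (simp add: joint_input_def)
qed

lemma measurable_state:
  fixes S :: "nat \<Rightarrow> 'w \<Rightarrow> real^'n::finite^'n" and \<psi> :: "('s, 'n, 'm::finite) law"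
  assumes \<psi>: "limited_info \<psi>"
  shows "(\<And>j. j < k \<Longrightarrow> S j \<in> borel_measurable N) \<Longrightarrow>
    (\<lambda>\<omega>. state sx su B \<psi> x0 (\<lambda>j. S j \<omega>) k) \<in> borel_measurable N"
proof (induction k rule: less_induct)
  case (less k)
  show ?case
  proof (cases k)
    case (Suc l)
    have st: "(\<lambda>\<omega>. state sx su B \<psi> x0 (\<lambda>j. S j \<omega>) j) \<in> borel_measurable N" if "j \<le> l" for j
      using less that Suc by simp
    have "(\<lambda>\<omega>. \<lambda>j\<in>{..l}. state sx su B \<psi> x0 (\<lambda>j. S j \<omega>) j) \<in> N \<rightarrow>\<^sub>M (\<Pi>\<^sub>M j\<in>{..l}. borel)"
      by (rule measurable_restrict) (simp add: st)
    moreover have "S l \<in> borel_measurable N" using less.prems Suc by simp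
    ultimately show ?thesis unfolding Suc state.simps
      by (intro borel_measurable_add borel_measurable_matrix_vector_mult measurable_joint_input \<psi> st)
         simp_all
  qed simp
qed

lemma measurable_state_hist:
  fixes S :: "nat \<Rightarrow> 'w \<Rightarrow> real^'n::finite^'n" and \<psi> :: "('s, 'n, 'm::finite) law"
  assumes "limited_info \<psi>" "\<And>j. j < k \<Longrightarrow> S j \<in> borel_measurable N"
  shows "(\<lambda>\<omega>. \<lambda>j\<in>{..k}. state sx su B \<psi> x0 (\<lambda>j. S j \<omega>) j) \<in> N \<rightarrow>\<^sub>M (\<Pi>\<^sub>M j\<in>{..k}. borel)"
  by (rule measurable_restrict) (use assms in \<open>auto intro!: measurable_state\<close>)

lemma nn_integral_distr_borel:
  "T \<in> M \<rightarrow>\<^sub>M N \<Longrightarrow> f \<in> borel_measurable N \<Longrightarrow> (\<integral>\<^sup>+x. f x \<partial>distr M N T) = (\<integral>\<^sup>+\<omega>. f (T \<omega>) \<partial>M)"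
  by (rule nn_integral_distr) simp_all

text \<open>The networked system of the theorem: rows of the system matrices are independent across
  subsystems and over time, with a time-invariant distribution.\<close>

locale networked_system = prob_space M for M :: "'w measure" +
  fixes sx :: "'n::finite \<Rightarrow> 's::finite" and su :: "'m::finite \<Rightarrow> 's"
    and A :: "nat \<Rightarrow> 'w \<Rightarrow> real^'n^'n" and B :: "real^'m^'n"
    and Q :: "real^'n^'n" and R :: "real^'m^'m"
  assumes A_measurable: "\<And>k. A k \<in> borel_measurable M"
    and A_sq: "\<And>k a b. integrable M (\<lambda>\<omega>. (A k \<omega> $ a $ b)\<^sup>2)"
    and A_indep: "indep_vars (\<lambda>_. borel)
           (\<lambda>(i, k) \<omega>. block_row sx i (A k \<omega>)) (UNIV :: ('s \<times> nat) set)"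
    and A_dist: "\<And>k. distr M borel (A k) = distr M borel (A 0)"
    and Q_pos: "sym_pos_def Q" and R_pos_def: "sym_pos_def R"
begin

sublocale random_step M sx su "A 0" B R
proof
  show "sq_integrable M (A 0)" by (intro sq_integrable_iff_entries A_measurable A_sq)
  show "indep_var borel (\<lambda>\<omega>. block_row sx i (A 0 \<omega>)) borel (\<lambda>\<omega>. block_row sx j (A 0 \<omega>))"
    if "i \<noteq> j" for i j
  proof -
    let ?X = "\<lambda>(i, k) \<omega>. block_row sx i (A k \<omega>)"
    have "indep_var borel ((\<lambda>r. r (i, 0::nat)) \<circ> (\<lambda>\<omega>. restrict (\<lambda>p. ?X p \<omega>) {(i, 0)}))
       borel ((\<lambda>r. r (j, 0::nat)) \<circ> (\<lambda>\<omega>. restrict (\<lambda>p. ?X p \<omega>) {(j, 0)}))"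
      by (rule indep_var_compose[OF indep_var_restrict[OF A_indep]])
        (use that in \<open>auto intro!: measurable_component_singleton\<close>)
    then show ?thesis by (simp add: comp_def)
  qed
  show "sym_pos_def R" by (rule R_pos_def)
qed

lemma mean_eq: "mean = mean_mat M A"
  by (simp add: mean_def mean_mat_def)

lemma modified_riccati_eq_iff: "modified_riccati_eq M sx su A B Q R P \<longleftrightarrow> P = Q + riccati_map P"
  by (simp add: modified_riccati_eq_def riccati_map_def mean_eq dev_def add.assoc)

text \<open>Conditioning on the first \<open>k\<close> system matrices: \<open>A k\<close> is independent of them and distributed
  like \<open>A 0\<close>, so it may be replaced by an independent copy of \<open>A 0\<close> under a second integral.\<close>

lemma nn_integral_condition_past:
  assumes f: "(\<lambda>(h, S). f h S) \<in> borel_measurable ((\<Pi>\<^sub>M j\<in>{..<k}. borel) \<Otimes>\<^sub>M borel)"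
  shows "(\<integral>\<^sup>+\<omega>. f (\<lambda>j\<in>{..<k}. A j \<omega>) (A k \<omega>) \<partial>M) = (\<integral>\<^sup>+\<omega>. \<integral>\<^sup>+\<omega>'. f (\<lambda>j\<in>{..<k}. A j \<omega>) (A 0 \<omega>') \<partial>M \<partial>M)"
proof -
  let ?X = "\<lambda>(i, k) \<omega>. block_row sx i (A k \<omega>)"
  let ?N = "\<lambda>J. (\<Pi>\<^sub>M j\<in>J. borel) :: (nat \<Rightarrow> real^'n^'n) measure"
  \<comment> \<open>Both random variables are families of matrices indexed by a set of times, since independence
    of a pair is stated for variables of the same type; for \<open>A k\<close> the index set is \<open>{k}\<close>.\<close>
  let ?H = "\<lambda>J \<omega>. \<lambda>j\<in>J. A j \<omega>"
  let ?Y = "\<lambda>J r. \<lambda>j\<in>J. \<Sum>i\<in>UNIV. (r (i, j) :: real^'n^'n)"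
  let ?I = "UNIV \<times> {..<k} :: ('s \<times> nat) set" and ?J = "UNIV \<times> {k} :: ('s \<times> nat) set"
  have Y: "?Y J \<in> (\<Pi>\<^sub>M p\<in>UNIV \<times> J. borel) \<rightarrow>\<^sub>M ?N J" for J
    by (intro measurable_restrict borel_measurable_sum measurable_component_singleton) simp
  have "indep_var (?N {..<k}) (?Y {..<k} \<circ> (\<lambda>\<omega>. restrict (\<lambda>p. ?X p \<omega>) ?I))
      (?N {k}) (?Y {k} \<circ> (\<lambda>\<omega>. restrict (\<lambda>p. ?X p \<omega>) ?J))"
    by (rule indep_var_compose[OF indep_var_restrict[OF A_indep] Y Y]) auto
  moreover have "?Y J \<circ> (\<lambda>\<omega>. restrict (\<lambda>p. ?X p \<omega>) (UNIV \<times> J)) = ?H J" for J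
    by (auto simp: fun_eq_iff sum_block_row)
  ultimately have "indep_var (?N {..<k}) (?H {..<k}) (?N {k}) (?H {k})" by simp
  then have H: "?H {..<k} \<in> M \<rightarrow>\<^sub>M ?N {..<k}" and K: "?H {k} \<in> M \<rightarrow>\<^sub>M ?N {k}"
    and joint: "distr M (?N {..<k}) (?H {..<k}) \<Otimes>\<^sub>M distr M (?N {k}) (?H {k})
      = distr M (?N {..<k} \<Otimes>\<^sub>M ?N {k}) (\<lambda>\<omega>. (?H {..<k} \<omega>, ?H {k} \<omega>))"
    by (auto simp: indep_var_distribution_eq)
  interpret AK: prob_space "distr M (?N {k}) (?H {k})"
    by (rule prob_space_distr) (rule K)
  let ?f = "\<lambda>p. f (fst p) (snd p k)"
  have "(\<lambda>p. (fst p, snd p k)) \<in> ?N {..<k} \<Otimes>\<^sub>M ?N {k} \<rightarrow>\<^sub>M ?N {..<k} \<Otimes>\<^sub>M borel"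
    by (intro measurable_Pair measurable_fst measurable_compose[OF measurable_snd]
        measurable_component_singleton) simp
  from measurable_compose[OF this f]
  have f1: "?f \<in> borel_measurable (?N {..<k} \<Otimes>\<^sub>M ?N {k})" by simp
  then have f': "?f \<in> borel_measurable (distr M (?N {..<k}) (?H {..<k}) \<Otimes>\<^sub>M distr M (?N {k}) (?H {k}))"
    by (simp cong: measurable_cong_sets sets_pair_measure_cong)
  have sec: "(\<lambda>S. f h S) \<in> borel_measurable borel" if "h \<in> space (?N {..<k})" for h
    using measurable_Pair2[OF f that] by simp
  have "(\<integral>\<^sup>+\<omega>. f (?H {..<k} \<omega>) (A k \<omega>) \<partial>M)
      = (\<integral>\<^sup>+p. ?f p \<partial>distr M (?N {..<k} \<Otimes>\<^sub>M ?N {k}) (\<lambda>\<omega>. (?H {..<k} \<omega>, ?H {k} \<omega>)))"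
    by (subst nn_integral_distr_borel[OF measurable_Pair[OF H K] f1]) simp
  also have "\<dots> = (\<integral>\<^sup>+h. \<integral>\<^sup>+g. f h (g k) \<partial>distr M (?N {k}) (?H {k}) \<partial>distr M (?N {..<k}) (?H {..<k}))"
    using AK.nn_integral_fst[OF f'] by (simp only: joint) simp
  also have "\<dots> = (\<integral>\<^sup>+\<omega>. \<integral>\<^sup>+g. f (?H {..<k} \<omega>) (g k) \<partial>distr M (?N {k}) (?H {k}) \<partial>M)"
  proof (rule nn_integral_distr_borel[OF H])
    show "(\<lambda>h. \<integral>\<^sup>+g. f h (g k) \<partial>distr M (?N {k}) (?H {k})) \<in> borel_measurable (?N {..<k})"
      using AK.borel_measurable_nn_integral_fst[OF f'] by simp
  qed
  also have "\<dots> = (\<integral>\<^sup>+\<omega>. \<integral>\<^sup>+\<omega>'. f (?H {..<k} \<omega>) (A 0 \<omega>') \<partial>M \<partial>M)"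
  proof (rule nn_integral_cong)
    fix \<omega> assume "\<omega> \<in> space M"
    then have "?H {..<k} \<omega> \<in> space (?N {..<k})" using H by (rule measurable_space[rotated])
    note s = sec[OF this]
    have "(\<integral>\<^sup>+g. f (?H {..<k} \<omega>) (g k) \<partial>distr M (?N {k}) (?H {k})) = (\<integral>\<^sup>+\<omega>'. f (?H {..<k} \<omega>) (A k \<omega>') \<partial>M)"
      by (subst nn_integral_distr_borel[OF K])
         (auto intro!: measurable_compose[OF _ s] measurable_component_singleton)
    also have "\<dots> = (\<integral>\<^sup>+S. f (?H {..<k} \<omega>) S \<partial>distr M borel (A k))"
      by (rule nn_integral_distr_borel[OF A_measurable s, symmetric])
    also have "\<dots> = (\<integral>\<^sup>+S. f (?H {..<k} \<omega>) S \<partial>distr M borel (A 0))"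
      by (simp only: A_dist[of k])
    also have "\<dots> = (\<integral>\<^sup>+\<omega>'. f (?H {..<k} \<omega>) (A 0 \<omega>') \<partial>M)"
      by (rule nn_integral_distr_borel[OF A_measurable s])
    finally show "(\<integral>\<^sup>+g. f (?H {..<k} \<omega>) (g k) \<partial>distr M (?N {k}) (?H {k})) = (\<integral>\<^sup>+\<omega>'. f (?H {..<k} \<omega>) (A 0 \<omega>') \<partial>M)" .
  qed
  finally show ?thesis .
qed

text \<open>State, history of states, and input along the closed loop of a law.\<close>

abbreviation traj :: "('s, 'n, 'm) law \<Rightarrow> real^'n \<Rightarrow> nat \<Rightarrow> 'w \<Rightarrow> real^'n" where
  "traj \<psi> x0 k \<omega> \<equiv> state sx su B \<psi> x0 (\<lambda>j. A j \<omega>) k"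

abbreviation hist :: "('s, 'n, 'm) law \<Rightarrow> real^'n \<Rightarrow> nat \<Rightarrow> 'w \<Rightarrow> nat \<Rightarrow> real^'n" where
  "hist \<psi> x0 k \<omega> \<equiv> \<lambda>j\<in>{..k}. traj \<psi> x0 j \<omega>"

abbreviation inp :: "('s, 'n, 'm) law \<Rightarrow> real^'n \<Rightarrow> nat \<Rightarrow> 'w \<Rightarrow> real^'m" where
  "inp \<psi> x0 k \<omega> \<equiv> joint_input sx su \<psi> k (A k \<omega>) (hist \<psi> x0 k \<omega>)"

lemma measurable_traj: "limited_info \<psi> \<Longrightarrow> traj \<psi> x0 k \<in> borel_measurable M"
  by (intro measurable_state A_measurable)

lemma measurable_hist: "limited_info \<psi> \<Longrightarrow> hist \<psi> x0 k \<in> M \<rightarrow>\<^sub>M (\<Pi>\<^sub>M j\<in>{..k}. borel)"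
  by (intro measurable_state_hist A_measurable)

lemma measurable_inp: "limited_info \<psi> \<Longrightarrow> inp \<psi> x0 k \<in> borel_measurable M"
  by (intro measurable_joint_input A_measurable measurable_hist)

lemma nn_integral_condition_history:
  assumes \<psi>: "limited_info \<psi>"
    and G: "(\<lambda>(h, S). G h S) \<in> borel_measurable ((\<Pi>\<^sub>M j\<in>{..k}. borel) \<Otimes>\<^sub>M borel)"
  shows "(\<integral>\<^sup>+\<omega>. G (hist \<psi> x0 k \<omega>) (A k \<omega>) \<partial>M) = (\<integral>\<^sup>+\<omega>. \<integral>\<^sup>+\<omega>'. G (hist \<psi> x0 k \<omega>) (A 0 \<omega>') \<partial>M \<partial>M)"
proof -
  let ?h = "\<lambda>r. \<lambda>j\<in>{..k}. state sx su B \<psi> x0 r j"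
  \<comment> \<open>The history up to time \<open>k\<close> is a function of the matrices at times before \<open>k\<close>.\<close>
  have eq: "?h (\<lambda>j\<in>{..<k}. A j \<omega>) = hist \<psi> x0 k \<omega>" for \<omega>
    by (intro restrict_ext state_cong) simp
  let ?N = "(\<Pi>\<^sub>M j\<in>{..<k}. borel) \<Otimes>\<^sub>M borel :: ((nat \<Rightarrow> real^'n^'n) \<times> (real^'n^'n)) measure"
  have "(\<lambda>p. \<lambda>j\<in>{..k}. state sx su B \<psi> x0 (\<lambda>j. fst p j) j) \<in> ?N \<rightarrow>\<^sub>M (\<Pi>\<^sub>M j\<in>{..k}. borel)"
    by (rule measurable_state_hist[OF \<psi>])
       (auto intro!: measurable_compose[OF measurable_fst] measurable_component_singleton)
  then have "(\<lambda>p. (?h (fst p), snd p)) \<in> ?N \<rightarrow>\<^sub>M (\<Pi>\<^sub>M j\<in>{..k}. borel) \<Otimes>\<^sub>M borel"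
    by (intro measurable_Pair) auto
  from measurable_compose[OF this G] have "(\<lambda>(r, S). G (?h r) S) \<in> borel_measurable ?N"
    by (simp add: case_prod_beta')
  from nn_integral_condition_past[OF this] show ?thesis by (simp only: eq)
qed

abbreviation optimal :: "real^'n^'n \<Rightarrow> ('s, 'n, 'm) law" where
  "optimal P \<equiv> opt_law M sx su A B R P"

lemma limited_info_optimal: "limited_info (optimal P)"
  unfolding limited_info_def
proof (intro allI)
  fix i and k :: nat
  have [measurable]: "(\<lambda>p. snd p k) \<in> borel \<Otimes>\<^sub>M (\<Pi>\<^sub>M j\<in>{..k}. borel) \<rightarrow>\<^sub>M (borel :: (real^'n) measure)"
    by (intro measurable_compose[OF measurable_snd] measurable_component_singleton) simp
  have [measurable]: "(\<lambda>p. fst p) \<in> borel \<Otimes>\<^sub>M (\<Pi>\<^sub>M j\<in>{..k}. borel :: (real^'n) measure) \<rightarrow>\<^sub>M (borel :: (real^'n^'n) measure)"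
    by measurable
  show "(\<lambda>(S, h). optimal P i k S h) \<in> borel \<Otimes>\<^sub>M (\<Pi>\<^sub>M j\<in>{..k}. borel) \<rightarrow>\<^sub>M borel"
    unfolding opt_law_def Let_def case_prod_beta'
    by (intro borel_measurable_diff borel_measurable_uminus borel_measurable_matrix_vector_mult
         borel_measurable_matrix_matrix_mult) simp_all
qed

lemma joint_input_optimal:
  assumes "psd P"
  shows "joint_input sx su (optimal P) k (A 0 \<omega>) h = opt_input P (h k) \<omega>"
  unfolding opt_input_def vec_eq_iff vector_minus_component vector_uminus_component local_gain_sum_component[OF assms]
  by (simp add: joint_input_def opt_law_def Let_def mean_eq dev_eq mean_gain_def local_gain_def
      weight_def local_weight_def matrix_vector_mul_assoc)

lemma joint_input_optimal_cong:
  "h k = h' k \<Longrightarrow> joint_input sx su (optimal P) k S h = joint_input sx su (optimal P) k S h'"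
  by (simp add: joint_input_def opt_law_def Let_def)

text \<open>Once the history is frozen, a law with limited model information is a decentralized input.\<close>

lemma decentralized_joint_input:
  assumes \<psi>: "limited_info \<psi>" and h: "h \<in> space (\<Pi>\<^sub>M j\<in>{..k}. borel)"
  shows "decentralized (\<lambda>\<omega>. joint_input sx su \<psi> k (A 0 \<omega>) h)"
  unfolding decentralized_def
proof (intro exI conjI allI ballI)
  let ?w = "\<lambda>c S. \<psi> (su c) k S h $ c"
  show "?w c \<in> borel_measurable borel" for c
  proof (rule borel_measurable_vec_nth)
    have "(\<lambda>(S, h). \<psi> (su c) k S h) \<in> borel \<Otimes>\<^sub>M (\<Pi>\<^sub>M j\<in>{..k}. borel) \<rightarrow>\<^sub>M borel"
      using \<psi> by (simp add: limited_info_def)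
    from measurable_Pair1[OF this h] show "(\<lambda>S. \<psi> (su c) k S h) \<in> borel_measurable borel" by simp
  qed
qed (simp add: joint_input_def)

text \<open>The one-step identity along the closed loop of an arbitrary law. The deviation is measured from
  the optimal feedback evaluated at the states that this law produces.\<close>

lemma stage_identity:
  assumes \<psi>: "limited_info \<psi>" and P: "psd P"
  shows "(\<integral>\<^sup>+\<omega>. ennreal (quad R (inp \<psi> x0 k \<omega>) + quad P (traj \<psi> x0 (Suc k) \<omega>)) \<partial>M)
    = (\<integral>\<^sup>+\<omega>. ennreal (quad (riccati_map P) (traj \<psi> x0 k \<omega>)) \<partial>M)
     + (\<integral>\<^sup>+\<omega>. ennreal (quad (weight P) (inp \<psi> x0 k \<omega>
           - joint_input sx su (optimal P) k (A k \<omega>) (hist \<psi> x0 k \<omega>))) \<partial>M)"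
    (is "?L = ?V + ?D")
proof -
  let ?N = "(\<Pi>\<^sub>M j\<in>{..k}. borel) \<Otimes>\<^sub>M borel :: ((nat \<Rightarrow> real^'n) \<times> (real^'n^'n)) measure"
  define G where "G h S = ennreal (quad R (joint_input sx su \<psi> k S h)
      + quad P (S *v h k + B *v joint_input sx su \<psi> k S h))" for h S
  define D where "D h S = ennreal (quad (weight P) (joint_input sx su \<psi> k S h
           - joint_input sx su (optimal P) k S h))" for h S
  have hk [measurable]: "(\<lambda>p. fst p k) \<in> borel_measurable ?N"
    by (intro measurable_compose[OF measurable_fst] measurable_component_singleton) simp
  have S [measurable]: "(\<lambda>p. snd p) \<in> borel_measurable ?N" by measurable
  have u [measurable]: "(\<lambda>p. joint_input sx su \<psi>' k (snd p) (fst p)) \<in> borel_measurable ?N"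
    if "limited_info \<psi>'" for \<psi>'
    by (intro measurable_joint_input that) auto
  have Gm: "(\<lambda>(h, S). G h S) \<in> borel_measurable ?N"
    unfolding G_def case_prod_beta'
    by (intro measurable_compose[OF _ measurable_ennreal] borel_measurable_add borel_measurable_quad
        borel_measurable_matrix_vector_mult u hk S \<psi>) simp
  have Dm: "(\<lambda>(h, S). D h S) \<in> borel_measurable ?N"
    unfolding D_def case_prod_beta'
    by (intro measurable_compose[OF _ measurable_ennreal] borel_measurable_diff borel_measurable_quad
        u \<psi> limited_info_optimal)
  have "?L = (\<integral>\<^sup>+\<omega>. G (hist \<psi> x0 k \<omega>) (A k \<omega>) \<partial>M)"
    by (simp add: G_def)
  also have "\<dots> = (\<integral>\<^sup>+\<omega>. \<integral>\<^sup>+\<omega>'. G (hist \<psi> x0 k \<omega>) (A 0 \<omega>') \<partial>M \<partial>M)"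
    by (rule nn_integral_condition_history[OF \<psi> Gm])
  also have "\<dots> = (\<integral>\<^sup>+\<omega>. ennreal (quad (riccati_map P) (traj \<psi> x0 k \<omega>))
      + (\<integral>\<^sup>+\<omega>'. D (hist \<psi> x0 k \<omega>) (A 0 \<omega>') \<partial>M) \<partial>M)"
  proof (rule nn_integral_cong)
    fix \<omega> assume "\<omega> \<in> space M"
    then have "hist \<psi> x0 k \<omega> \<in> space (\<Pi>\<^sub>M j\<in>{..k}. borel)"
      by (rule measurable_space[OF measurable_hist[OF \<psi>]])
    from stage_cost[OF P decentralized_joint_input[OF \<psi> this]]
    show "(\<integral>\<^sup>+\<omega>'. G (hist \<psi> x0 k \<omega>) (A 0 \<omega>') \<partial>M) = ennreal (quad (riccati_map P) (traj \<psi> x0 k \<omega>))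
      + (\<integral>\<^sup>+\<omega>'. D (hist \<psi> x0 k \<omega>) (A 0 \<omega>') \<partial>M)"
      by (simp add: G_def D_def joint_input_optimal[OF P])
  qed
  also have "\<dots> = ?V + (\<integral>\<^sup>+\<omega>. \<integral>\<^sup>+\<omega>'. D (hist \<psi> x0 k \<omega>) (A 0 \<omega>') \<partial>M \<partial>M)"
  proof (rule nn_integral_add)
    show "(\<lambda>\<omega>. ennreal (quad (riccati_map P) (traj \<psi> x0 k \<omega>))) \<in> borel_measurable M"
      by (intro measurable_compose[OF _ measurable_ennreal] borel_measurable_quad measurable_traj \<psi>)
    have "(\<lambda>p. (hist \<psi> x0 k (fst p), A 0 (snd p))) \<in> M \<Otimes>\<^sub>M M \<rightarrow>\<^sub>M ?N"
      by (intro measurable_Pair measurable_compose[OF measurable_fst measurable_hist[OF \<psi>]]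
         measurable_compose[OF measurable_snd A_measurable])
    from measurable_compose[OF this Dm]
    show "(\<lambda>\<omega>. \<integral>\<^sup>+\<omega>'. D (hist \<psi> x0 k \<omega>) (A 0 \<omega>') \<partial>M) \<in> borel_measurable M"
      by (intro borel_measurable_nn_integral) (simp add: case_prod_beta')
  qed
  also have "(\<integral>\<^sup>+\<omega>. \<integral>\<^sup>+\<omega>'. D (hist \<psi> x0 k \<omega>) (A 0 \<omega>') \<partial>M \<partial>M) = ?D"
    by (subst nn_integral_condition_history[OF \<psi> Dm, symmetric]) (simp add: D_def)
  finally show ?thesis .
qed

end

section \<open>Optimality of the feedback of a Riccati solution\<close>

lemma ennreal_terms_tendsto_zero:
  fixes c :: "nat \<Rightarrow> ennreal"
  assumes "(\<Sum>k. c k) \<noteq> \<infinity>"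
  shows "c \<longlonglongrightarrow> 0"
proof -
  have s: "(\<lambda>T. \<Sum>k<T. c k) \<longlonglongrightarrow> (\<Sum>k. c k)"
    by (rule summable_LIMSEQ) (rule summableI)
  have fin: "(\<Sum>k<T. c k) \<noteq> \<infinity>" for T
  proof -
    have "(\<Sum>k<T. c k) \<le> (\<Sum>k. c k)" by (intro sum_le_suminf summableI) simp_all
    then show ?thesis using assms by (metis infinity_ennreal_def top_unique)
  qed
  \<comment> \<open>The terms are differences of consecutive partial sums, which are finite.\<close>
  have "(\<lambda>T. (\<Sum>k<Suc T. c k) - (\<Sum>k<T. c k)) \<longlonglongrightarrow> (\<Sum>k. c k) - (\<Sum>k. c k)"
    using assms by (intro tendsto_diff_ennreal LIMSEQ_Suc[OF s] s) simp_all
  moreover have "(\<Sum>k<Suc T. c k) - (\<Sum>k<T. c k) = c T" for T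
    unfolding lessThan_Suc using fin[of T] by (simp add: add.commute ennreal_add_diff_cancel_right)
  ultimately show ?thesis using assms by (simp add: ennreal_diff_self)
qed

context networked_system
begin

text \<open>The expected stage cost at time \<open>k\<close>, the expected quadratic form of the state at time \<open>k\<close>, and
  the expected loss at time \<open>k\<close> from deviating from the optimal feedback, all in \<open>[0, \<infinity>]\<close>.\<close>

definition stage_term :: "('s, 'n, 'm) law \<Rightarrow> real^'n \<Rightarrow> nat \<Rightarrow> ennreal" where
  "stage_term \<psi> x0 k = (\<integral>\<^sup>+\<omega>. ennreal (quad Q (traj \<psi> x0 k \<omega>) + quad R (inp \<psi> x0 k \<omega>)) \<partial>M)"

definition terminal :: "real^'n^'n \<Rightarrow> ('s, 'n, 'm) law \<Rightarrow> real^'n \<Rightarrow> nat \<Rightarrow> ennreal" where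
  "terminal P \<psi> x0 k = (\<integral>\<^sup>+\<omega>. ennreal (quad P (traj \<psi> x0 k \<omega>)) \<partial>M)"

definition regret :: "real^'n^'n \<Rightarrow> ('s, 'n, 'm) law \<Rightarrow> real^'n \<Rightarrow> nat \<Rightarrow> ennreal" where
  "regret P \<psi> x0 k = (\<integral>\<^sup>+\<omega>. ennreal (quad (weight P) (inp \<psi> x0 k \<omega>
           - joint_input sx su (optimal P) k (A k \<omega>) (hist \<psi> x0 k \<omega>))) \<partial>M)"

lemma Q_nonneg: "0 \<le> quad Q x" and R_nonneg: "0 \<le> quad R y"
  using Q_pos R_pos by (auto intro!: psd_quad_nonneg sym_pos_def_imp_psd)

lemma measurable_quad_traj: "limited_info \<psi> \<Longrightarrow> (\<lambda>\<omega>. ennreal (quad P (traj \<psi> x0 k \<omega>))) \<in> borel_measurable M"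
  by (intro measurable_compose[OF _ measurable_ennreal] borel_measurable_quad measurable_traj)

lemma measurable_quad_inp: "limited_info \<psi> \<Longrightarrow> (\<lambda>\<omega>. ennreal (quad W (inp \<psi> x0 k \<omega>))) \<in> borel_measurable M"
  by (intro measurable_compose[OF _ measurable_ennreal] borel_measurable_quad measurable_inp)

lemma stage_term_eq:
  assumes "limited_info \<psi>"
  shows "stage_term \<psi> x0 k = terminal Q \<psi> x0 k + (\<integral>\<^sup>+\<omega>. ennreal (quad R (inp \<psi> x0 k \<omega>)) \<partial>M)"
proof -
  have "stage_term \<psi> x0 k
      = (\<integral>\<^sup>+\<omega>. ennreal (quad Q (traj \<psi> x0 k \<omega>)) + ennreal (quad R (inp \<psi> x0 k \<omega>)) \<partial>M)"
    unfolding stage_term_def by (intro nn_integral_cong ennreal_plus Q_nonneg R_nonneg)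
  also have "\<dots> = terminal Q \<psi> x0 k + (\<integral>\<^sup>+\<omega>. ennreal (quad R (inp \<psi> x0 k \<omega>)) \<partial>M)"
    unfolding terminal_def by (rule nn_integral_add) (intro measurable_quad_traj measurable_quad_inp assms)+
  finally show ?thesis .
qed

lemma cost_eq:
  assumes \<psi>: "limited_info \<psi>"
  shows "cost M sx su A B Q R x0 \<psi> = (\<Sum>k. stage_term \<psi> x0 k)"
proof -
  have "(\<integral>\<^sup>+\<omega>. ennreal (\<Sum>k<T. quad Q (traj \<psi> x0 k \<omega>) + quad R (inp \<psi> x0 k \<omega>)) \<partial>M)
      = (\<Sum>k<T. stage_term \<psi> x0 k)" for T
  proof -
    have "(\<integral>\<^sup>+\<omega>. ennreal (\<Sum>k<T. quad Q (traj \<psi> x0 k \<omega>) + quad R (inp \<psi> x0 k \<omega>)) \<partial>M)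
      = (\<integral>\<^sup>+\<omega>. (\<Sum>k<T. ennreal (quad Q (traj \<psi> x0 k \<omega>) + quad R (inp \<psi> x0 k \<omega>))) \<partial>M)"
      by (intro nn_integral_cong sum_ennreal[symmetric] add_nonneg_nonneg Q_nonneg R_nonneg)
    also have "\<dots> = (\<Sum>k<T. stage_term \<psi> x0 k)"
      unfolding stage_term_def
      by (intro nn_integral_sum measurable_compose[OF _ measurable_ennreal] borel_measurable_add
          borel_measurable_quad measurable_traj measurable_inp \<psi>)
    finally show ?thesis .
  qed
  then have "cost M sx su A B Q R x0 \<psi> = lim (\<lambda>T. \<Sum>k<T. stage_term \<psi> x0 k)"
    by (simp add: cost_def ctrl_def Let_def quad_def)
  also have "\<dots> = (\<Sum>k. stage_term \<psi> x0 k)"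
    by (rule limI[OF summable_LIMSEQ[OF summableI]])
  finally show ?thesis .
qed

lemma step_identity:
  assumes \<psi>: "limited_info \<psi>" and P: "psd P"
  shows "(\<integral>\<^sup>+\<omega>. ennreal (quad R (inp \<psi> x0 k \<omega>)) \<partial>M) + terminal P \<psi> x0 (Suc k)
    = terminal (riccati_map P) \<psi> x0 k + regret P \<psi> x0 k"
proof -
  have "(\<integral>\<^sup>+\<omega>. ennreal (quad R (inp \<psi> x0 k \<omega>)) \<partial>M) + terminal P \<psi> x0 (Suc k)
    = (\<integral>\<^sup>+\<omega>. ennreal (quad R (inp \<psi> x0 k \<omega>)) + ennreal (quad P (traj \<psi> x0 (Suc k) \<omega>)) \<partial>M)"
    unfolding terminal_def
    by (rule nn_integral_add[symmetric]) (intro measurable_quad_traj measurable_quad_inp \<psi>)+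
  also have "\<dots> = (\<integral>\<^sup>+\<omega>. ennreal (quad R (inp \<psi> x0 k \<omega>) + quad P (traj \<psi> x0 (Suc k) \<omega>)) \<partial>M)"
    by (intro nn_integral_cong ennreal_plus[symmetric] R_nonneg psd_quad_nonneg[OF P])
  also have "\<dots> = terminal (riccati_map P) \<psi> x0 k + regret P \<psi> x0 k"
    unfolding terminal_def regret_def by (rule stage_identity[OF \<psi> P])
  finally show ?thesis .
qed

lemma terminal_add:
  assumes "limited_info \<psi>" "psd Y" "psd Z"
  shows "terminal (Y + Z) \<psi> x0 k = terminal Y \<psi> x0 k + terminal Z \<psi> x0 k"
proof -
  have "terminal Y \<psi> x0 k + terminal Z \<psi> x0 k
      = (\<integral>\<^sup>+\<omega>. ennreal (quad Y (traj \<psi> x0 k \<omega>)) + ennreal (quad Z (traj \<psi> x0 k \<omega>)) \<partial>M)"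
    unfolding terminal_def by (rule nn_integral_add[symmetric]) (intro measurable_quad_traj assms)+
  then show ?thesis
    using assms by (simp add: terminal_def quad_add psd_quad_nonneg)
qed

lemma terminal_0: "0 \<le> quad P x0 \<Longrightarrow> terminal P \<psi> x0 0 = ennreal (quad P x0)"
  by (simp add: terminal_def emeasure_space_1)

context
  fixes P :: "real^'n^'n"
  assumes P_pos: "sym_pos_def P" and P_eq: "P = Q + riccati_map P"
begin

lemma P_psd: "psd P" by (rule sym_pos_def_imp_psd[OF P_pos])

lemma stage_plus_terminal:
  assumes \<psi>: "limited_info \<psi>"
  shows "stage_term \<psi> x0 k + terminal P \<psi> x0 (Suc k) = terminal P \<psi> x0 k + regret P \<psi> x0 k"
proof -
  have "terminal P \<psi> x0 k = terminal Q \<psi> x0 k + terminal (riccati_map P) \<psi> x0 k"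
    by (subst P_eq) (intro terminal_add \<psi> sym_pos_def_imp_psd Q_pos psd_riccati_map P_psd)
  moreover have "stage_term \<psi> x0 k + terminal P \<psi> x0 (Suc k)
    = terminal Q \<psi> x0 k + ((\<integral>\<^sup>+\<omega>. ennreal (quad R (inp \<psi> x0 k \<omega>)) \<partial>M) + terminal P \<psi> x0 (Suc k))"
    by (simp add: stage_term_eq[OF \<psi>] add.assoc)
  ultimately show ?thesis by (simp add: step_identity[OF \<psi> P_psd] add.assoc)
qed

text \<open>Both sides may be infinite; stating the identity with sums on both sides avoids cancellation in
  \<open>[0, \<infinity>]\<close>.\<close>

lemma partial_cost:
  assumes \<psi>: "limited_info \<psi>"
  shows "(\<Sum>k<T. stage_term \<psi> x0 k) + terminal P \<psi> x0 T = ennreal (quad P x0) + (\<Sum>k<T. regret P \<psi> x0 k)"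
proof (induction T)
  case 0
  show ?case by (simp add: terminal_0 psd_quad_nonneg[OF P_psd])
next
  case (Suc T)
  have "(\<Sum>k<Suc T. stage_term \<psi> x0 k) + terminal P \<psi> x0 (Suc T)
      = (\<Sum>k<T. stage_term \<psi> x0 k) + (stage_term \<psi> x0 T + terminal P \<psi> x0 (Suc T))"
    by (simp add: add.assoc)
  also have "\<dots> = ((\<Sum>k<T. stage_term \<psi> x0 k) + terminal P \<psi> x0 T) + regret P \<psi> x0 T"
    by (simp add: stage_plus_terminal[OF \<psi>] add.assoc)
  finally show ?case by (simp add: Suc.IH add.assoc)
qed

text \<open>\<open>Q\<close> dominates a multiple of \<open>P\<close>, because it is positive definite.\<close>

lemma terminal_le_stage:
  assumes \<psi>: "limited_info \<psi>"
  shows "\<exists>K. \<forall>k. terminal P \<psi> x0 k \<le> ennreal K * stage_term \<psi> x0 k"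
proof -
  obtain c where c: "c \<ge> 0" "\<And>x. quad P x \<le> c * (x \<bullet> x)" using quad_upper[of P] by blast
  obtain d where d: "d > 0" "\<And>x. d * (x \<bullet> x) \<le> quad Q x" using quad_lower[OF Q_pos] by blast
  have le: "quad P x \<le> c / d * quad Q x" for x
  proof -
    have "c * (x \<bullet> x) = c / d * (d * (x \<bullet> x))" using d by simp
    also have "\<dots> \<le> c / d * quad Q x" using c d by (intro mult_left_mono) auto
    finally show ?thesis using c(2)[of x] by linarith
  qed
  have "terminal P \<psi> x0 k \<le> ennreal (c / d) * stage_term \<psi> x0 k" for k
  proof -
    have "terminal P \<psi> x0 k \<le> (\<integral>\<^sup>+\<omega>. ennreal (c / d) * ennreal (quad Q (traj \<psi> x0 k \<omega>)) \<partial>M)"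
      unfolding terminal_def using le c d
      by (intro nn_integral_mono) (simp add: ennreal_mult'[symmetric] ennreal_leI Q_nonneg)
    also have "\<dots> = ennreal (c / d) * terminal Q \<psi> x0 k"
      unfolding terminal_def by (intro nn_integral_cmult measurable_quad_traj \<psi>)
    also have "\<dots> \<le> ennreal (c / d) * stage_term \<psi> x0 k"
      unfolding stage_term_eq[OF \<psi>] by (intro mult_left_mono) simp_all
    finally show ?thesis .
  qed
  then show ?thesis by blast
qed

lemma terminal_tendsto_zero:
  assumes \<psi>: "limited_info \<psi>" and fin: "cost M sx su A B Q R x0 \<psi> \<noteq> \<infinity>"
  shows "terminal P \<psi> x0 \<longlonglongrightarrow> 0"
proof -
  obtain K where K: "\<And>k. terminal P \<psi> x0 k \<le> ennreal K * stage_term \<psi> x0 k"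
    using terminal_le_stage[OF \<psi>] by blast
  have "stage_term \<psi> x0 \<longlonglongrightarrow> 0"
    using fin unfolding cost_eq[OF \<psi>] by (rule ennreal_terms_tendsto_zero)
  then have "(\<lambda>k. ennreal K * stage_term \<psi> x0 k) \<longlonglongrightarrow> ennreal K * 0"
    by (intro ennreal_tendsto_cmult) simp_all
  then show ?thesis
    by (intro tendsto_sandwich[of "\<lambda>_. 0" "terminal P \<psi> x0" sequentially "\<lambda>k. ennreal K * stage_term \<psi> x0 k" 0])
      (simp_all add: K)
qed

lemma cost_regret:
  assumes \<psi>: "limited_info \<psi>" and fin: "cost M sx su A B Q R x0 \<psi> \<noteq> \<infinity>"
  shows "cost M sx su A B Q R x0 \<psi> = ennreal (quad P x0) + (\<Sum>k. regret P \<psi> x0 k)"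
proof (rule LIMSEQ_unique)
  show "(\<lambda>T. (\<Sum>k<T. stage_term \<psi> x0 k) + terminal P \<psi> x0 T) \<longlonglongrightarrow> cost M sx su A B Q R x0 \<psi>"
    unfolding cost_eq[OF \<psi>]
    using tendsto_add[OF summable_LIMSEQ[OF summableI] terminal_tendsto_zero[OF \<psi> fin], of "stage_term \<psi> x0"]
    by simp
  show "(\<lambda>T. (\<Sum>k<T. stage_term \<psi> x0 k) + terminal P \<psi> x0 T)
      \<longlonglongrightarrow> ennreal (quad P x0) + (\<Sum>k. regret P \<psi> x0 k)"
    unfolding partial_cost[OF \<psi>]
    by (intro tendsto_add tendsto_const summable_LIMSEQ summableI)
qed

lemma cost_lower_bound:
  assumes "limited_info \<psi>"
  shows "ennreal (quad P x0) \<le> cost M sx su A B Q R x0 \<psi>"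
proof (cases "cost M sx su A B Q R x0 \<psi> = \<infinity>")
  case False
  then show ?thesis unfolding cost_regret[OF assms False] by simp
qed simp

lemma regret_optimal: "regret P (optimal P) x0 k = 0"
  by (simp add: regret_def)

lemma partial_cost_optimal:
  "(\<Sum>k<T. stage_term (optimal P) x0 k) + terminal P (optimal P) x0 T = ennreal (quad P x0)"
  by (simp add: partial_cost[OF limited_info_optimal] regret_optimal)

lemma cost_optimal: "cost M sx su A B Q R x0 (optimal P) = ennreal (quad P x0)"
proof -
  have "(\<Sum>k<T. stage_term (optimal P) x0 k) \<le> ennreal (quad P x0)" for T
    using partial_cost_optimal[of x0 T] by (metis le_iff_add)
  then have "cost M sx su A B Q R x0 (optimal P) \<le> ennreal (quad P x0)"
    unfolding cost_eq[OF limited_info_optimal] by (intro suminf_le_const summableI)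
  then have "cost M sx su A B Q R x0 (optimal P) \<noteq> \<infinity>" by (auto simp: top_unique)
  from cost_regret[OF limited_info_optimal this] show ?thesis by (simp add: regret_optimal)
qed

text \<open>The optimal feedback depends on the history through the current state only, so a law that agrees
  with it along its own trajectory follows the optimal trajectory.\<close>

lemma traj_eq_optimal:
  assumes "\<And>k. inp \<psi> x0 k \<omega> = joint_input sx su (optimal P) k (A k \<omega>) (hist \<psi> x0 k \<omega>)"
  shows "traj \<psi> x0 k \<omega> = traj (optimal P) x0 k \<omega>"
proof (induction k)
  case (Suc k)
  have "inp \<psi> x0 k \<omega> = inp (optimal P) x0 k \<omega>"
    unfolding assms by (rule joint_input_optimal_cong) (simp add: Suc)
  then show ?case by (simp only: state.simps Suc)
qed simp

lemma minimizer_unique: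
  assumes \<psi>: "limited_info \<psi>" and eq: "cost M sx su A B Q R x0 \<psi> = ennreal (quad P x0)"
  shows "AE \<omega> in M. \<forall>k. ctrl sx su B \<psi> x0 (\<lambda>j. A j \<omega>) k = ctrl sx su B (optimal P) x0 (\<lambda>j. A j \<omega>) k"
proof -
  have "ennreal (quad P x0) + 0 = ennreal (quad P x0) + (\<Sum>k. regret P \<psi> x0 k)"
    using cost_regret[OF \<psi>, of x0] by (simp add: eq)
  then have "(\<Sum>k. regret P \<psi> x0 k) = 0"
    by (subst (asm) ennreal_add_left_cancel) simp
  then have zero: "regret P \<psi> x0 k = 0" for k
    using sum_le_suminf[OF summableI, of "{k}" "regret P \<psi> x0"] by simp
  have "AE \<omega> in M. inp \<psi> x0 k \<omega> = joint_input sx su (optimal P) k (A k \<omega>) (hist \<psi> x0 k \<omega>)" for k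
  proof -
    let ?e = "\<lambda>\<omega>. inp \<psi> x0 k \<omega> - joint_input sx su (optimal P) k (A k \<omega>) (hist \<psi> x0 k \<omega>)"
    have "(\<lambda>\<omega>. ennreal (quad (weight P) (?e \<omega>))) \<in> borel_measurable M"
      by (intro measurable_compose[OF _ measurable_ennreal] borel_measurable_quad borel_measurable_diff
          measurable_inp \<psi> measurable_joint_input limited_info_optimal A_measurable measurable_hist)
    then have "AE \<omega> in M. ennreal (quad (weight P) (?e \<omega>)) = 0"
      using zero[of k] unfolding regret_def by (subst (asm) nn_integral_0_iff_AE)
    then show ?thesis
    proof (rule AE_mp, intro AE_I2 impI)
      fix \<omega> assume "ennreal (quad (weight P) (?e \<omega>)) = 0"
      then have "quad (weight P) (?e \<omega>) \<le> 0" by (simp add: ennreal_eq_0_iff)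
      then have "?e \<omega> = 0" using weight_pos[OF P_psd] unfolding sym_pos_def_quad by (meson not_less)
      then show "inp \<psi> x0 k \<omega> = joint_input sx su (optimal P) k (A k \<omega>) (hist \<psi> x0 k \<omega>)" by simp
    qed
  qed
  then have "AE \<omega> in M. \<forall>k. inp \<psi> x0 k \<omega> = joint_input sx su (optimal P) k (A k \<omega>) (hist \<psi> x0 k \<omega>)"
    by (simp add: AE_all_countable)
  then show ?thesis
  proof (rule AE_mp, intro AE_I2 impI allI)
    fix \<omega> k assume *: "\<forall>k. inp \<psi> x0 k \<omega> = joint_input sx su (optimal P) k (A k \<omega>) (hist \<psi> x0 k \<omega>)"
    have "inp \<psi> x0 k \<omega> = inp (optimal P) x0 k \<omega>"
      unfolding *[rule_format] by (rule joint_input_optimal_cong) (simp add: traj_eq_optimal[OF *[rule_format]])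
    then show "ctrl sx su B \<psi> x0 (\<lambda>j. A j \<omega>) k = ctrl sx su B (optimal P) x0 (\<lambda>j. A j \<omega>) k"
      by (simp add: ctrl_def)
  qed
qed

lemma optimal_stable: "mean_square_stable M sx su A B (optimal P)"
  unfolding mean_square_stable_def Let_def
proof (intro allI conjI)
  fix x0
  let ?x = "traj (optimal P) x0"
  have P: "0 \<le> quad P x" for x by (rule psd_quad_nonneg[OF P_psd])
  have sq: "sq_integrable M (?x k)" for k
  proof (rule sq_integrable_of_quad[OF P_pos measurable_traj[OF limited_info_optimal]])
    have "terminal P (optimal P) x0 k \<le> ennreal (quad P x0)"
      using partial_cost_optimal[of x0 k] by (metis add.commute le_iff_add)
    then show "(\<integral>\<^sup>+\<omega>. ennreal (quad P (?x k \<omega>)) \<partial>M) < \<infinity>"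
      unfolding terminal_def by (simp add: order_le_less_trans)
  qed
  then show "integrable M (\<lambda>\<omega>. ?x k \<omega> \<bullet> ?x k \<omega>)" for k by (simp add: sq_integrable_def)
  obtain d where d: "d > 0" "\<And>x. d * (x \<bullet> x) \<le> quad P x" using quad_lower[OF P_pos] by blast
  have "terminal P (optimal P) x0 \<longlonglongrightarrow> 0"
    using terminal_tendsto_zero[OF limited_info_optimal] by (simp add: cost_optimal)
  moreover have "terminal P (optimal P) x0 = (\<lambda>k. ennreal (\<integral>\<omega>. quad P (?x k \<omega>) \<partial>M))"
    unfolding terminal_def by (intro ext nn_integral_eq_integral sq_integrable_quad sq AE_I2 P)
  ultimately have "(\<lambda>k. ennreal (\<integral>\<omega>. quad P (?x k \<omega>) \<partial>M)) \<longlonglongrightarrow> 0" by (simp only:)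
  then have "(\<lambda>k. \<integral>\<omega>. quad P (?x k \<omega>) \<partial>M) \<longlonglongrightarrow> 0"
    by (subst (asm) ennreal_tendsto_0_iff) (intro Bochner_Integration.integral_nonneg P)
  then have lim: "(\<lambda>k. (\<integral>\<omega>. quad P (?x k \<omega>) \<partial>M) / d) \<longlonglongrightarrow> 0" by (rule tendsto_divide_zero)
  have "(\<integral>\<omega>. ?x k \<omega> \<bullet> ?x k \<omega> \<partial>M) \<le> (\<integral>\<omega>. quad P (?x k \<omega>) \<partial>M) / d" for k
  proof -
    have "(\<integral>\<omega>. ?x k \<omega> \<bullet> ?x k \<omega> \<partial>M) \<le> (\<integral>\<omega>. quad P (?x k \<omega>) / d \<partial>M)"
      using sq[of k] d by (intro integral_mono integrable_divide sq_integrable_quad)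
        (auto simp: sq_integrable_def field_simps)
    then show ?thesis by simp
  qed
  then show "(\<lambda>k. \<integral>\<omega>. ?x k \<omega> \<bullet> ?x k \<omega> \<partial>M) \<longlonglongrightarrow> 0"
    by (intro tendsto_sandwich[OF _ _ tendsto_const lim]) (simp_all add: Bochner_Integration.integral_nonneg)
qed

lemma inf_cost: "(INF \<psi>\<in>{\<psi>. limited_info \<psi>}. cost M sx su A B Q R x0 \<psi>) = ennreal (quad P x0)"
proof (rule antisym)
  show "(INF \<psi>\<in>{\<psi>. limited_info \<psi>}. cost M sx su A B Q R x0 \<psi>) \<le> ennreal (quad P x0)"
    using limited_info_optimal[of P] by (intro INF_lower2[of "optimal P"]) (simp_all add: cost_optimal)
  show "ennreal (quad P x0) \<le> (INF \<psi>\<in>{\<psi>. limited_info \<psi>}. cost M sx su A B Q R x0 \<psi>)"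
    by (intro INF_greatest cost_lower_bound) simp
qed

end

text \<open>The infimum of the cost determines the quadratic form of every positive definite solution.\<close>

lemma riccati_solution_unique:
  assumes "sym_pos_def P" "P = Q + riccati_map P" "sym_pos_def P'" "P' = Q + riccati_map P'"
  shows "P' = P"
proof (rule sym_mat_eqI)
  show "transpose P' = P'" "transpose P = P" using assms by (auto simp: sym_pos_def_def)
  fix x
  have "ennreal (quad P' x) = ennreal (quad P x)"
    using inf_cost[OF assms(1,2), of x] inf_cost[OF assms(3,4), of x] by simp
  then show "quad P' x = quad P x"
    using assms by (simp add: psd_quad_nonneg sym_pos_def_imp_psd)
qed

end

section \<open>Existence of a Riccati solution by value iteration\<close>

context networked_system
begin

text \<open>The optimal cost matrix for horizon \<open>T\<close> with zero terminal cost.\<close>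

primrec value_iter :: "nat \<Rightarrow> real^'n^'n" where
  "value_iter 0 = 0"
| "value_iter (Suc T) = Q + riccati_map (value_iter T)"

lemma psd_value_iter: "psd (value_iter T)"
  by (induction T) (simp_all add: psd_zero psd_add psd_riccati_map sym_pos_def_imp_psd[OF Q_pos])

lemma value_iter_mono: "quad (value_iter T) x \<le> quad (value_iter (Suc T)) x"
proof (induction T arbitrary: x)
  case 0
  show ?case using psd_quad_nonneg[OF psd_value_iter[of "Suc 0"]] by simp
next
  case (Suc T)
  have "quad (riccati_map (value_iter T)) x \<le> quad (riccati_map (value_iter (Suc T))) x"
    by (intro riccati_map_mono psd_value_iter Suc.IH)
  then show ?case by (simp add: quad_add)
qed

lemma riccati_solution_exists_if_bounded:
  assumes bound: "\<And>T x. quad (value_iter T) x \<le> quad Z x"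
  shows "\<exists>P. sym_pos_def P \<and> P = Q + riccati_map P"
proof -
  have inc: "incseq (\<lambda>T. quad (value_iter T) x)" for x
    by (intro incseq_SucI value_iter_mono)
  have "convergent (\<lambda>T. quad (value_iter T) x)" for x
    using incseq_convergent[OF inc, of x "quad Z x"] bound by (metis convergentI)
  from sym_mat_convergent[OF psd_transpose[OF psd_value_iter] this]
  obtain P where P: "value_iter \<longlonglongrightarrow> P" by blast
  have limq: "(\<lambda>T. quad (value_iter T) x) \<longlonglongrightarrow> quad P x" for x by (rule tendsto_quad[OF P])
  have le: "quad (value_iter T) x \<le> quad P x" for T x by (rule incseq_le[OF inc limq])
  have "(\<lambda>T. transpose (value_iter T)) \<longlonglongrightarrow> transpose P"
    by (rule bounded_linear.tendsto[OF bounded_linear_transpose P])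
  then have "value_iter \<longlonglongrightarrow> transpose P" by (simp only: psd_transpose[OF psd_value_iter])
  from LIMSEQ_unique[OF P this] have tP: "transpose P = P" by (rule sym)
  have "quad Q x \<le> quad P x" for x
    using le[of "Suc 0" x] psd_quad_nonneg[OF psd_riccati_map[OF psd_zero], of x] by (simp add: quad_add)
  then have P_pos: "sym_pos_def P"
    using tP Q_pos unfolding sym_pos_def_quad by (meson less_le_trans)
  then have P_psd: "psd P" by (rule sym_pos_def_imp_psd)
  have upper: "quad P x \<le> quad Q x + quad (riccati_map P) x" for x
  proof (rule LIMSEQ_le_const2[OF LIMSEQ_Suc[OF limq[of x]]], intro exI allI impI)
    show "quad (value_iter (Suc T)) x \<le> quad Q x + quad (riccati_map P) x" for T
      unfolding value_iter.simps quad_add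
      by (intro add_left_mono riccati_map_mono psd_value_iter P_psd le)
  qed
  obtain d where d: "d > 0" "\<And>x. d * (x \<bullet> x) \<le> quad P x" using quad_lower[OF P_pos] by blast
  \<comment> \<open>For \<open>c < 1\<close> a late iterate dominates \<open>c P\<close>, uniformly in the state because \<open>P\<close> is positive
    definite.\<close>
  have lower: "c * quad (riccati_map P) x \<le> quad P x - quad Q x" if c: "0 < c" "c < 1" for c x
  proof -
    have "(\<lambda>T. P - value_iter T) \<longlonglongrightarrow> P - P" by (intro tendsto_diff tendsto_const P)
    then have "(\<lambda>T. P - value_iter T) \<longlonglongrightarrow> 0" by simp
    from eventually_happens'[OF _ eventually_quad_small[OF this, of "(1 - c) * d"]] c d
    obtain T where T: "\<And>x. quad (P - value_iter T) x \<le> (1 - c) * d * (x \<bullet> x)" by force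
    have "quad (c *\<^sub>R P) y \<le> quad (value_iter T) y" for y
    proof -
      have "quad P y - quad (value_iter T) y \<le> (1 - c) * (d * (y \<bullet> y))"
        using T[of y] by (simp add: quad_diff)
      also have "\<dots> \<le> (1 - c) * quad P y" using c d by (intro mult_left_mono) simp_all
      finally show ?thesis by (simp add: quad_scaleR algebra_simps)
    qed
    then have "quad (riccati_map (c *\<^sub>R P)) x \<le> quad (riccati_map (value_iter T)) x"
      using c by (intro riccati_map_mono psd_scaleR P_psd psd_value_iter) simp_all
    moreover have "c * quad (riccati_map P) x \<le> quad (riccati_map (c *\<^sub>R P)) x"
      using c by (intro riccati_map_scale P_psd) simp_all
    ultimately show ?thesis using le[of "Suc T" x] by (simp add: quad_add)
  qed
  have "quad (riccati_map P) x \<le> quad P x - quad Q x" for x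
    by (rule field_le_mult_one_interval) (rule lower)
  then have eq: "quad P x = quad (Q + riccati_map P) x" for x
    using upper[of x] by (simp add: quad_add order_antisym add.commute le_diff_eq)
  have "psd (Q + riccati_map P)"
    by (rule psd_add[OF sym_pos_def_imp_psd[OF Q_pos] psd_riccati_map[OF P_psd]])
  from sym_mat_eqI[OF tP psd_transpose[OF this] eq] have "P = Q + riccati_map P" .
  with P_pos show ?thesis by blast
qed

context
  fixes \<Gamma> :: "'s \<Rightarrow> real^'n^'n \<Rightarrow> real^'n^'m"
  assumes \<Gamma>_measurable: "\<And>i. \<Gamma> i \<in> borel_measurable borel"
    and stable: "mean_square_stable M sx su A B (\<lambda>i k S h. \<Gamma> i S *v h k)"
    and B_block: "block_diagonal sx su B"
begin

text \<open>A stabilizing feedback, its joint gain matrix as a function of the system matrix, and the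
  resulting closed-loop matrix.\<close>

abbreviation stabilizer :: "('s, 'n, 'm) law" where
  "stabilizer \<equiv> \<lambda>i k S h. \<Gamma> i S *v h k"

definition joint_gain :: "real^'n^'n \<Rightarrow> real^'n^'m" where
  "joint_gain S = (\<chi> c. \<Gamma> (su c) (block_row sx (su c) S) $ c)"

definition closed_loop :: "real^'n^'n \<Rightarrow> real^'n^'n" where
  "closed_loop S = S + B ** joint_gain S"

text \<open>The adjoint of the map that takes the second moment matrix of the state to that of the next
  state.\<close>

definition moment_op :: "real^'n^'n \<Rightarrow> real^'n^'n" where
  "moment_op Y = (\<integral>\<omega>. transpose (closed_loop (A 0 \<omega>)) ** Y ** closed_loop (A 0 \<omega>) \<partial>M)"

lemma joint_gain_mult: "(joint_gain S *v x) $ c = (\<Gamma> (su c) (block_row sx (su c) S) *v x) $ c"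
  by (simp add: matrix_vector_mul_component joint_gain_def)

lemma joint_gain_measurable: "joint_gain \<in> borel_measurable borel"
  unfolding joint_gain_def[abs_def]
proof (rule borel_measurable_vecI)
  fix c
  have "(\<lambda>S. \<Gamma> (su c) (block_row sx (su c) S)) \<in> borel_measurable borel"
    by (rule measurable_compose[OF borel_measurable_block_row \<Gamma>_measurable]) simp
  then show "(\<lambda>S. (\<chi> c. \<Gamma> (su c) (block_row sx (su c) S) $ c) $ c) \<in> borel_measurable borel"
    by (simp add: borel_measurable_vec_nth)
qed

lemma closed_loop_measurable: "closed_loop \<in> borel_measurable borel"
  unfolding closed_loop_def[abs_def]
  by (intro borel_measurable_add borel_measurable_matrix_matrix_mult joint_gain_measurable) simp_all

lemma limited_info_stabilizer: "limited_info stabilizer"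
  unfolding limited_info_def
proof (intro allI)
  fix i and k :: nat
  show "(\<lambda>(S, h). \<Gamma> i S *v h k) \<in> borel \<Otimes>\<^sub>M (\<Pi>\<^sub>M j\<in>{..k}. borel) \<rightarrow>\<^sub>M borel"
    unfolding case_prod_beta'
    by (intro borel_measurable_matrix_vector_mult measurable_compose[OF measurable_fst \<Gamma>_measurable]
       measurable_compose[OF measurable_snd] measurable_component_singleton) simp
qed

lemma joint_input_stabilizer: "joint_input sx su stabilizer k S h = joint_gain S *v h k"
  by (simp add: joint_input_def vec_eq_iff joint_gain_mult)

lemma traj_stabilizer_Suc: "traj stabilizer x0 (Suc k) \<omega> = closed_loop (A k \<omega>) *v traj stabilizer x0 k \<omega>"
  by (simp add: joint_input_stabilizer closed_loop_def matrix_vector_mult_add_rdistrib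
      matrix_vector_mul_assoc)

lemma traj_stabilizer_sq: "sq_integrable M (traj stabilizer x0 k)"
  using stable measurable_traj[OF limited_info_stabilizer]
  by (simp add: sq_integrable_def mean_square_stable_def Let_def)

text \<open>The columns of the closed-loop matrix are the states at time \<open>1\<close> for the initial states
  \<open>axis b 1\<close>, which have finite second moments by stability. The gain itself need not be square
  integrable, since \<open>B\<close> may have a kernel.\<close>

lemma closed_loop_sq: "sq_integrable M (\<lambda>\<omega>. closed_loop (A 0 \<omega>))"
proof (intro sq_integrable_vecI)
  fix a b
  have "sq_integrable M (\<lambda>\<omega>. traj stabilizer (axis b 1) (Suc 0) \<omega> $ a)"
    by (rule sq_integrable_linear[OF bounded_linear_vec_nth traj_stabilizer_sq])
  moreover have "traj stabilizer (axis b 1) (Suc 0) \<omega> $ a = closed_loop (A 0 \<omega>) $ a $ b" for \<omega>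
    unfolding traj_stabilizer_Suc state.simps(1) by (simp add: matrix_vector_mul_component inner_axis)
  ultimately show "sq_integrable M (\<lambda>\<omega>. closed_loop (A 0 \<omega>) $ a $ b)" by (simp only:)
qed

lemma quad_moment_op: "quad (moment_op Y) x = (\<integral>\<omega>. quad Y (closed_loop (A 0 \<omega>) *v x) \<partial>M)"
  by (simp add: moment_op_def quad_integral sq_integrable_congruence[OF closed_loop_sq] quad_congruence)

lemma psd_moment_op: "psd Y \<Longrightarrow> psd (moment_op Y)"
  by (simp add: psd_def quad_moment_op Bochner_Integration.integral_nonneg)
    (simp add: moment_op_def transpose_integral sq_integrable_congruence[OF closed_loop_sq]
      matrix_transpose_mul matrix_mul_assoc)

lemma psd_moment_pow: "psd Y \<Longrightarrow> psd ((moment_op ^^ k) Y)"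
  by (induction k) (simp_all add: psd_moment_op)

lemma terminal_stabilizer_Suc:
  assumes "psd Y"
  shows "terminal Y stabilizer x0 (Suc k) = terminal (moment_op Y) stabilizer x0 k"
proof -
  let ?N = "(\<Pi>\<^sub>M j\<in>{..k}. borel) \<Otimes>\<^sub>M borel :: ((nat \<Rightarrow> real^'n) \<times> (real^'n^'n)) measure"
  let ?G = "\<lambda>h S. ennreal (quad Y (closed_loop S *v h k))"
  have "(\<lambda>(h, S). ?G h S) \<in> borel_measurable ?N"
    unfolding case_prod_beta'
    by (intro measurable_compose[OF _ measurable_ennreal] borel_measurable_quad
        borel_measurable_matrix_vector_mult measurable_compose[OF measurable_snd closed_loop_measurable]
        measurable_compose[OF measurable_fst] measurable_component_singleton) simp
  from nn_integral_condition_history[OF limited_info_stabilizer this, of x0]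
  have "terminal Y stabilizer x0 (Suc k)
      = (\<integral>\<^sup>+\<omega>. \<integral>\<^sup>+\<omega>'. ennreal (quad Y (closed_loop (A 0 \<omega>') *v traj stabilizer x0 k \<omega>)) \<partial>M \<partial>M)"
    unfolding terminal_def traj_stabilizer_Suc by simp
  also have "\<dots> = (\<integral>\<^sup>+\<omega>. ennreal (quad (moment_op Y) (traj stabilizer x0 k \<omega>)) \<partial>M)"
    unfolding quad_moment_op
    by (intro nn_integral_cong nn_integral_eq_integral sq_integrable_quad sq_integrable_mv
        closed_loop_sq AE_I2 psd_quad_nonneg assms)
  finally show ?thesis by (simp add: terminal_def)
qed

lemma terminal_stabilizer: "psd Y \<Longrightarrow> terminal Y stabilizer x0 k = ennreal (quad ((moment_op ^^ k) Y) x0)"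
proof (induction k arbitrary: Y)
  case 0
  then show ?case by (simp add: terminal_0 psd_quad_nonneg)
next
  case (Suc k)
  then show ?case
    by (simp add: terminal_stabilizer_Suc psd_moment_op funpow_swap1)
qed

lemma moment_pow_tendsto_zero: "(\<lambda>k. (moment_op ^^ k) (mat 1)) \<longlonglongrightarrow> 0"
proof -
  have q: "(\<lambda>k. quad ((moment_op ^^ k) (mat 1)) x) \<longlonglongrightarrow> 0" for x
  proof -
    let ?x = "traj stabilizer x"
    have "ennreal (quad ((moment_op ^^ k) (mat 1)) x) = ennreal (\<integral>\<omega>. ?x k \<omega> \<bullet> ?x k \<omega> \<partial>M)" for k
    proof -
      have "integrable M (\<lambda>\<omega>. ?x k \<omega> \<bullet> ?x k \<omega>)"
        using traj_stabilizer_sq by (simp add: sq_integrable_def)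
      then show ?thesis
        by (simp add: terminal_stabilizer[OF psd_mat_1, symmetric] terminal_def nn_integral_eq_integral)
    qed
    then have "quad ((moment_op ^^ k) (mat 1)) x = (\<integral>\<omega>. ?x k \<omega> \<bullet> ?x k \<omega> \<partial>M)" for k
      by (subst (asm) ennreal_inj)
        (simp_all add: Bochner_Integration.integral_nonneg psd_quad_nonneg psd_moment_pow psd_mat_1)
    moreover have "(\<lambda>k. \<integral>\<omega>. ?x k \<omega> \<bullet> ?x k \<omega> \<partial>M) \<longlonglongrightarrow> 0"
      using stable by (simp add: mean_square_stable_def Let_def)
    ultimately show ?thesis by simp
  qed
  have tr: "transpose ((moment_op ^^ k) (mat 1)) = (moment_op ^^ k) (mat 1)" for k
    by (intro psd_transpose psd_moment_pow psd_mat_1)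
  have "convergent (\<lambda>k. quad ((moment_op ^^ k) (mat 1)) x)" for x
    using q by (rule convergentI)
  from sym_mat_convergent[OF tr this] obtain Z where Z: "(\<lambda>k. (moment_op ^^ k) (mat 1)) \<longlonglongrightarrow> Z" by blast
  have "(\<lambda>k. transpose ((moment_op ^^ k) (mat 1))) \<longlonglongrightarrow> transpose Z"
    by (rule bounded_linear.tendsto[OF bounded_linear_transpose Z])
  then have "(\<lambda>k. (moment_op ^^ k) (mat 1)) \<longlonglongrightarrow> transpose Z" by (simp only: tr)
  from LIMSEQ_unique[OF Z this] have tZ: "transpose Z = Z" by simp
  have "quad Z x = quad 0 x" for x
    using LIMSEQ_unique[OF tendsto_quad[OF Z] q] by simp
  from sym_mat_eqI[OF tZ psd_transpose[OF psd_zero] this] have "Z = 0" .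
  with Z show ?thesis by simp
qed

lemma lyapunov_matrix: "\<exists>Z. psd Z \<and> (\<forall>x. x \<bullet> x + quad (moment_op Z) x \<le> quad Z x)"
proof -
  let ?a = "\<lambda>k. (moment_op ^^ k) (mat 1)"
  obtain N where N: "\<And>x. quad (?a N) x \<le> 1 / 2 * (x \<bullet> x)"
    using eventually_happens'[OF _ eventually_quad_small[OF moment_pow_tendsto_zero, of "1/2"]] by force
  \<comment> \<open>The factor \<open>2\<close> absorbs the remainder \<open>q (L\<^sup>N I)\<close>, which is at most half of \<open>q I\<close>.\<close>
  define Z where "Z = 2 *\<^sub>R (\<Sum>k<N. ?a k)"
  have "psd Z" unfolding Z_def by (intro psd_scaleR psd_sum psd_moment_pow psd_mat_1) simp
  moreover have "x \<bullet> x + quad (moment_op Z) x \<le> quad Z x" for x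
  proof -
    have "quad (moment_op Z) x = (\<integral>\<omega>. 2 * (\<Sum>k<N. quad (?a k) (closed_loop (A 0 \<omega>) *v x)) \<partial>M)"
      by (simp add: quad_moment_op Z_def quad_scaleR quad_sum)
    also have "\<dots> = 2 * (\<Sum>k<N. quad (?a (Suc k)) x)"
      by (simp add: quad_moment_op sq_integrable_quad sq_integrable_mv closed_loop_sq)
    also have "(\<Sum>k<N. quad (?a (Suc k)) x) = (\<Sum>k<N. quad (?a k) x) - x \<bullet> x + quad (?a N) x"
      using sum.lessThan_Suc_shift[of "\<lambda>k. quad (?a k) x" N] by (simp del: funpow.simps(2))
    finally show ?thesis using N[of x] by (simp add: Z_def quad_scaleR quad_sum)
  qed
  ultimately show ?thesis by blast
qed

text \<open>Induction on the horizon, comparing with the cost of a square integrable version of the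
  stabilizing feedback.\<close>

lemma value_iter_bounded: "\<exists>Z. \<forall>T x. quad (value_iter T) x \<le> quad Z x"
proof -
  obtain G where G: "block_diagonal su sx G" "B ** G ** B = B"
    using block_diagonal_generalized_inverse[OF B_block] by blast
  \<comment> \<open>The gain \<open>K\<close> has the same effect on the state as the stabilizing gain. It is square
    integrable, being a linear image of the closed-loop matrix minus the system matrix, and
    decentralized because \<open>G\<close> and \<open>B\<close> are block diagonal.\<close>
  define K where "K \<omega> = G ** (B ** joint_gain (A 0 \<omega>))" for \<omega>
  have BK: "A 0 \<omega> *v x + B *v (K \<omega> *v x) = closed_loop (A 0 \<omega>) *v x" for \<omega> x
    using G(2) by (simp add: K_def closed_loop_def matrix_vector_mult_add_rdistrib
        matrix_vector_mul_assoc matrix_mul_assoc)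
  have sqK: "sq_integrable M K"
  proof -
    have "sq_integrable M (\<lambda>\<omega>. G ** (closed_loop (A 0 \<omega>) - A 0 \<omega>))"
      by (intro sq_integrable_linear[OF bounded_linear_matrix_mult] sq_integrable_diff closed_loop_sq sq_X)
    then show ?thesis by (simp add: K_def[abs_def] closed_loop_def)
  qed
  have decK: "decentralized (\<lambda>\<omega>. K \<omega> *v x)" for x
    unfolding decentralized_def
  proof (intro exI conjI allI ballI)
    let ?w = "\<lambda>c S. \<Sum>a\<in>UNIV. G $ c $ a * (\<Sum>d\<in>UNIV. B $ a $ d * (\<Gamma> (su c) S *v x) $ d)"
    show "?w c \<in> borel_measurable borel" for c
      by (intro borel_measurable_sum borel_measurable_times borel_measurable_const
          borel_measurable_vec_nth borel_measurable_matrix_vector_mult \<Gamma>_measurable)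
    show "(K \<omega> *v x) $ c = ?w c (block_row sx (su c) (A 0 \<omega>))" for \<omega> c
    proof -
      have "(K \<omega> *v x) $ c = (\<Sum>a\<in>UNIV. G $ c $ a * (\<Sum>d\<in>UNIV. B $ a $ d * (joint_gain (A 0 \<omega>) *v x) $ d))"
        by (simp add: K_def matrix_vector_mul_assoc[symmetric])
          (simp add: matrix_vector_mult_def[of G] matrix_vector_mult_def[of B])
      also have "\<dots> = ?w c (block_row sx (su c) (A 0 \<omega>))"
        unfolding sum_distrib_left joint_gain_mult
      proof (intro sum.cong refl)
        fix a d
        show "G $ c $ a * (B $ a $ d * (\<Gamma> (su d) (block_row sx (su d) (A 0 \<omega>)) *v x) $ d)
            = G $ c $ a * (B $ a $ d * (\<Gamma> (su c) (block_row sx (su c) (A 0 \<omega>)) *v x) $ d)"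
        proof (cases "su c = sx a \<and> sx a = su d")
          case True
          then show ?thesis by simp
        next
          case False
          then have "G $ c $ a = 0 \<or> B $ a $ d = 0"
            using G(1) B_block by (auto simp: block_diagonal_def)
          then show ?thesis by auto
        qed
      qed
      finally show ?thesis .
    qed
  qed
  define Q1 where "Q1 = Q + (\<integral>\<omega>. transpose (K \<omega>) ** R ** K \<omega> \<partial>M)"
  have Q1: "quad Q1 x = quad Q x + (\<integral>\<omega>. quad R (K \<omega> *v x) \<partial>M)" for x
    by (simp add: Q1_def quad_add quad_integral sq_integrable_congruence[OF sqK] quad_congruence)
  obtain c where c: "c \<ge> 0" "\<And>x. quad Q1 x \<le> c * (x \<bullet> x)" using quad_upper[of Q1] by blast
  obtain Z where Z: "psd Z" "\<And>x. x \<bullet> x + quad (moment_op Z) x \<le> quad Z x" using lyapunov_matrix by blast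
  have "quad (value_iter T) x \<le> quad (c *\<^sub>R Z) x" for T x
  proof (induction T arbitrary: x)
    case 0
    show ?case using c Z by (simp add: quad_scaleR psd_quad_nonneg)
  next
    case (Suc T)
    let ?V = "value_iter T"
    have int: "integrable M (\<lambda>\<omega>. quad Y (closed_loop (A 0 \<omega>) *v x))" for Y
      by (intro sq_integrable_quad sq_integrable_mv closed_loop_sq)
    have "quad (riccati_map ?V) x \<le> (\<integral>\<omega>. quad R (K \<omega> *v x) + quad ?V (closed_loop (A 0 \<omega>) *v x) \<partial>M)"
      unfolding BK[symmetric] by (intro riccati_map_le psd_value_iter decK sq_integrable_mv sqK)
    also have "\<dots> = (\<integral>\<omega>. quad R (K \<omega> *v x) \<partial>M) + (\<integral>\<omega>. quad ?V (closed_loop (A 0 \<omega>) *v x) \<partial>M)"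
      by (intro Bochner_Integration.integral_add int sq_integrable_quad sq_integrable_mv sqK)
    also have "(\<integral>\<omega>. quad ?V (closed_loop (A 0 \<omega>) *v x) \<partial>M) \<le> (\<integral>\<omega>. quad (c *\<^sub>R Z) (closed_loop (A 0 \<omega>) *v x) \<partial>M)"
      by (intro integral_mono int Suc.IH)
    also have "\<dots> = c * quad (moment_op Z) x" by (simp add: quad_scaleR quad_moment_op)
    finally have "quad (value_iter (Suc T)) x \<le> quad Q1 x + c * quad (moment_op Z) x"
      by (simp add: quad_add Q1)
    also have "\<dots> \<le> c * (x \<bullet> x + quad (moment_op Z) x)"
      using c(2)[of x] by (simp add: distrib_left)
    also have "\<dots> \<le> quad (c *\<^sub>R Z) x"
      unfolding quad_scaleR by (intro mult_left_mono Z c)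
    finally show ?case .
  qed
  then show ?thesis by blast
qed

end

lemma riccati_solution_exists:
  assumes "mean_square_stabilizable M sx su A B" "block_diagonal sx su B"
  shows "\<exists>P. sym_pos_def P \<and> P = Q + riccati_map P"
proof -
  obtain \<Gamma> :: "'s \<Rightarrow> real^'n^'n \<Rightarrow> real^'n^'m" where "\<And>i. \<Gamma> i \<in> borel_measurable borel"
    "mean_square_stable M sx su A B (\<lambda>i k S h. \<Gamma> i S *v h k)"
    using assms(1) unfolding mean_square_stabilizable_def by blast
  from value_iter_bounded[OF this assms(2)] show ?thesis
    using riccati_solution_exists_if_bounded by blast
qed

end

theorem corollary3:
  fixes M :: "'w measure"
    and sx :: "'n::finite \<Rightarrow> 's::finite" and su :: "'m::finite \<Rightarrow> 's"
    and A :: "nat \<Rightarrow> 'w \<Rightarrow> real^'n^'n" and B :: "real^'m^'n"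
    and Q :: "real^'n^'n" and R :: "real^'m^'m"
  assumes "prob_space M"
    and "surj sx" and "surj su"
    and "block_diagonal sx su B"
    and "\<And>k. A k \<in> borel_measurable M"
    and "\<And>k a b. integrable M (\<lambda>\<omega>. A k \<omega> $ a $ b)"
    and "\<And>k a b. integrable M (\<lambda>\<omega>. (A k \<omega> $ a $ b)\<^sup>2)"
    and "prob_space.indep_vars M (\<lambda>_. borel)
           (\<lambda>(i, k) \<omega>. block_row sx i (A k \<omega>)) (UNIV :: ('s \<times> nat) set)"
    and "\<And>k. distr M borel (A k) = distr M borel (A 0)"
    and "mean_square_stabilizable M sx su A B"
    and "sym_pos_def Q"
    and "sym_pos_def R" and "block_diagonal su su R"
  shows "\<exists>P. sym_pos_def P \<and> modified_riccati_eq M sx su A B Q R P \<and>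
    (\<forall>P'. sym_pos_def P' \<and> modified_riccati_eq M sx su A B Q R P' \<longrightarrow> P' = P) \<and>
    limited_info (opt_law M sx su A B R P) \<and>
    (\<forall>x0. \<forall>\<psi>. limited_info \<psi> \<longrightarrow>
       cost M sx su A B Q R x0 (opt_law M sx su A B R P) \<le> cost M sx su A B Q R x0 \<psi> \<and>
       (cost M sx su A B Q R x0 \<psi> = cost M sx su A B Q R x0 (opt_law M sx su A B R P) \<longrightarrow>
         (AE \<omega> in M. \<forall>k. ctrl sx su B \<psi> x0 (\<lambda>j. A j \<omega>) k =
            ctrl sx su B (opt_law M sx su A B R P) x0 (\<lambda>j. A j \<omega>) k))) \<and>
    mean_square_stable M sx su A B (opt_law M sx su A B R P) \<and>
    (\<forall>x0. (INF \<psi>\<in>{\<psi>. limited_info \<psi>}. cost M sx su A B Q R x0 \<psi>) = ennreal (x0 \<bullet> (P *v x0)))"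
proof -
  interpret prob_space M by fact
  interpret networked_system M sx su A B Q R by unfold_locales (fact assms)+
  obtain P where P: "sym_pos_def P" "P = Q + riccati_map P"
    using riccati_solution_exists[OF assms(10,4)] by blast
  show ?thesis
  proof (intro exI[of _ P] conjI allI impI)
    show "sym_pos_def P" by (rule P(1))
    show "modified_riccati_eq M sx su A B Q R P"
      unfolding modified_riccati_eq_iff by (rule P(2))
    show "P' = P" if "sym_pos_def P' \<and> modified_riccati_eq M sx su A B Q R P'" for P'
      using that riccati_solution_unique[OF P] by (simp only: modified_riccati_eq_iff)
    show "limited_info (optimal P)" by (rule limited_info_optimal)
    show "mean_square_stable M sx su A B (optimal P)" by (rule optimal_stable[OF P])
    show "(INF \<psi>\<in>{\<psi>. limited_info \<psi>}. cost M sx su A B Q R x0 \<psi>) = ennreal (x0 \<bullet> (P *v x0))" for x0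
      using inf_cost[OF P] by (simp add: quad_def)
    fix x0 and \<psi> :: "('s, 'n, 'm) law"
    assume \<psi>: "limited_info \<psi>"
    show "cost M sx su A B Q R x0 (optimal P) \<le> cost M sx su A B Q R x0 \<psi>"
      unfolding cost_optimal[OF P] by (rule cost_lower_bound[OF P \<psi>])
    assume "cost M sx su A B Q R x0 \<psi> = cost M sx su A B Q R x0 (optimal P)"
    then show "AE \<omega> in M. \<forall>k. ctrl sx su B \<psi> x0 (\<lambda>j. A j \<omega>) k = ctrl sx su B (optimal P) x0 (\<lambda>j. A j \<omega>) k"
      unfolding cost_optimal[OF P] by (rule minimizer_unique[OF P \<psi>])
  qed
qed

end
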